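(* Let $G$ be a second countable locally compact group, let $a\in G$ be an aperiodic element, let $w$ be a weight on $G$ with $w,w^{-1}\in L^\infty(G)$, and let $\Phi$ be a $\Delta_2$-regular Young function. Let $T_{a,w}$ be the weighted translation $T_{a,w}f(x)=w(x)f(xa^{-1})$ on the Orlicz space $L^\Phi(G)$. If $T_{a,w}$ is chaotic or topologically mixing, then it is topologically multiply recurrent.
   Context: Locally compact groups are Hausdorff; $\lambda$ is a right Haar measure on $G$; $\mathbb{N}$ is the set of positive integers. An element $a\in G$ is aperiodic if the closed subgroup of $G$ generated by $a$ is not compact. A Young function is a continuous, even, convex function $\Phi:\mathbb{R}\to\mathbb{R}$ with $\Phi(0)=0$, $\Phi(t)>0$ for $t>0$, and $\lim_{t\to\infty}\Phi(t)=\infty$. It is $\Delta_2$-regular (relative to $G$) if there is a constant $M>0$ such that $\Phi(2t)\le M\Phi(t)$ for all $t>0$ when $G$ is noncompact; when $G$ is compact, it is only required that there exist $M>0$ and $t_0>0$ with $\Phi(2t)\le M\Phi(t)$ for all $t\ge t_0$. The Orlicz space $L^\Phi(G)$ is the Banach space of ($\lambda$-a.e. classes of) Borel measurable functions $f:G\to\mathbb{C}$ with $\int_G\Phi(\alpha|f|)\,d\lambda<\infty$ for some $\alpha>0$, with the Luxemburg norm $N_\Phi(f)=\inf\{k>0:\int_G\Phi(|f|/k)\,d\lambda\le 1\}$. A weight on $G$ is a bounded continuous function $w:G\to(0,\infty)$. For an operator $T$ on a separable Banach space $X$: $T$ is topologically transitive if for all nonempty open $U,V\subset X$ there is $n\in\mathbb{N}$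 with $T^nU\cap V\neq\emptyset$; $T$ is topologically mixing if for all nonempty open $U,V\subset X$ one has $T^nU\cap V\neq\emptyset$ for all $n$ from some point onwards; $T$ is chaotic if it is topologically transitive and the set of periodic elements ($x$ with $T^nx=x$ for some $n\in\mathbb{N}$) is dense in $X$; $T$ is topologically multiply recurrent if for every positive integer $L$ and every nonempty open $U\subset X$ there is $n\in\mathbb{N}$ with $U\cap T^{-n}U\cap T^{-2n}U\cap\cdots\cap T^{-Ln}U\neq\emptyset$. *)

theory Defs
  imports "HOL-Analysis.Analysis"
begin

section \<open>Locally compact groups\<close>

text \<open>
  Groups are written additively, since the library's class of topological groups is
  \<^class>\<open>topological_group_add\<close>.  This class does not assume commutativity:
  \<open>x + y\<close> stands for the product \<open>xy\<close>, and \<open>x - a = x + (- a)\<close> for \<open>x a\<inverse>\<close>.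
\<close>

definition is_subgroup :: "'g::group_add set \<Rightarrow> bool" where
  "is_subgroup H \<longleftrightarrow> 0 \<in> H \<and> (\<forall>x\<in>H. \<forall>y\<in>H. x + y \<in> H) \<and> (\<forall>x\<in>H. - x \<in> H)"

definition closed_subgroup_generated :: "'g::topological_group_add \<Rightarrow> 'g set" where
  "closed_subgroup_generated a = (\<lambda>H. closed H \<and> is_subgroup H) hull {a}"

definition aperiodic :: "'g::topological_group_add \<Rightarrow> bool" where
  "aperiodic a \<longleftrightarrow> \<not> compact (closed_subgroup_generated a)"

text \<open>A right Haar measure is a nonzero right-invariant Radon measure on the Borel sets.\<close>

definition right_haar_measure :: "'g::{topological_group_add, t2_space} measure \<Rightarrow> bool" where
  "right_haar_measure \<mu> \<longleftrightarrow>
     sets \<mu> = sets borel \<and>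
     emeasure \<mu> UNIV \<noteq> 0 \<and>
     (\<forall>K. compact K \<longrightarrow> emeasure \<mu> K < \<infinity>) \<and>
     (\<forall>A\<in>sets borel. emeasure \<mu> A = (INF U\<in>{U. open U \<and> A \<subseteq> U}. emeasure \<mu> U)) \<and>
     (\<forall>U. open U \<longrightarrow> emeasure \<mu> U = (SUP K\<in>{K. compact K \<and> K \<subseteq> U}. emeasure \<mu> K)) \<and>
     (\<forall>A\<in>sets borel. \<forall>g. emeasure \<mu> ((\<lambda>x. x + g) ` A) = emeasure \<mu> A)"

definition weight :: "('g::topological_space \<Rightarrow> real) \<Rightarrow> bool" where
  "weight w \<longleftrightarrow> continuous_on UNIV w \<and> bounded (range w) \<and> (\<forall>x. w x > 0)"

definition L_infinity :: "'g measure \<Rightarrow> ('g \<Rightarrow> real) set" where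
  "L_infinity \<mu> = {f \<in> borel_measurable \<mu>. \<exists>C. AE x in \<mu>. \<bar>f x\<bar> \<le> C}"


section \<open>Orlicz spaces\<close>

definition young_function :: "(real \<Rightarrow> real) \<Rightarrow> bool" where
  "young_function \<Phi> \<longleftrightarrow>
     continuous_on UNIV \<Phi> \<and> (\<forall>t. \<Phi> (- t) = \<Phi> t) \<and> convex_on UNIV \<Phi> \<and>
     \<Phi> 0 = 0 \<and> (\<forall>t>0. \<Phi> t > 0) \<and> filterlim \<Phi> at_top at_top"

definition delta2_regular :: "'g::topological_space set \<Rightarrow> (real \<Rightarrow> real) \<Rightarrow> bool" where
  "delta2_regular G \<Phi> \<longleftrightarrow>
     (if compact G
      then \<exists>M>0. \<exists>t0>0. \<forall>t\<ge>t0. \<Phi> (2 * t) \<le> M * \<Phi> t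
      else \<exists>M>0. \<forall>t>0. \<Phi> (2 * t) \<le> M * \<Phi> t)"

definition orlicz_functions :: "(real \<Rightarrow> real) \<Rightarrow> 'g measure \<Rightarrow> ('g \<Rightarrow> complex) set" where
  "orlicz_functions \<Phi> \<mu> =
     {f \<in> borel_measurable \<mu>. \<exists>\<alpha>>0. (\<integral>\<^sup>+x. ennreal (\<Phi> (\<alpha> * norm (f x))) \<partial>\<mu>) < \<infinity>}"

definition luxemburg_norm :: "(real \<Rightarrow> real) \<Rightarrow> 'g measure \<Rightarrow> ('g \<Rightarrow> complex) \<Rightarrow> real" where
  "luxemburg_norm \<Phi> \<mu> f =
     Inf {k. k > 0 \<and> (\<integral>\<^sup>+x. ennreal (\<Phi> (norm (f x) / k)) \<partial>\<mu>) \<le> 1}"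

definition orlicz_rel ::
    "(real \<Rightarrow> real) \<Rightarrow> 'g measure \<Rightarrow> (('g \<Rightarrow> complex) \<times> ('g \<Rightarrow> complex)) set" where
  "orlicz_rel \<Phi> \<mu> =
     {(f, g). f \<in> orlicz_functions \<Phi> \<mu> \<and> g \<in> orlicz_functions \<Phi> \<mu> \<and> (AE x in \<mu>. f x = g x)}"

definition orlicz_space :: "(real \<Rightarrow> real) \<Rightarrow> 'g measure \<Rightarrow> ('g \<Rightarrow> complex) set set" where
  "orlicz_space \<Phi> \<mu> = orlicz_functions \<Phi> \<mu> // orlicz_rel \<Phi> \<mu>"

text \<open>
  The norm distance of two classes, computed on arbitrary representatives.  The value \<open>0\<close>
  outside the space is immaterial; it is there because \<^locale>\<open>Metric_space\<close> asks for
  nonnegativity at all arguments.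
\<close>

definition orlicz_dist ::
    "(real \<Rightarrow> real) \<Rightarrow> 'g measure \<Rightarrow> ('g \<Rightarrow> complex) set \<Rightarrow> ('g \<Rightarrow> complex) set \<Rightarrow> real" where
  "orlicz_dist \<Phi> \<mu> F G =
     (if F \<in> orlicz_space \<Phi> \<mu> \<and> G \<in> orlicz_space \<Phi> \<mu>
      then luxemburg_norm \<Phi> \<mu> (\<lambda>x. (SOME f. f \<in> F) x - (SOME g. g \<in> G) x)
      else 0)"

definition orlicz_topology ::
    "(real \<Rightarrow> real) \<Rightarrow> 'g measure \<Rightarrow> ('g \<Rightarrow> complex) set topology" where
  "orlicz_topology \<Phi> \<mu> = Metric_space.mtopology (orlicz_space \<Phi> \<mu>) (orlicz_dist \<Phi> \<mu>)"

definition weighted_shift ::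
    "'g::group_add \<Rightarrow> ('g \<Rightarrow> real) \<Rightarrow> ('g \<Rightarrow> complex) \<Rightarrow> ('g \<Rightarrow> complex)" where
  "weighted_shift a w f = (\<lambda>x. of_real (w x) * f (x - a))"

text \<open>The operator induced on classes; see \<open>weighted_translation_class\<close> below.\<close>

definition weighted_translation ::
    "(real \<Rightarrow> real) \<Rightarrow> 'g measure \<Rightarrow> 'g::group_add \<Rightarrow> ('g \<Rightarrow> real) \<Rightarrow>
     ('g \<Rightarrow> complex) set \<Rightarrow> ('g \<Rightarrow> complex) set" where
  "weighted_translation \<Phi> \<mu> a w F = (\<Union>f\<in>F. orlicz_rel \<Phi> \<mu> `` {weighted_shift a w f})"


section \<open>Dynamics of a self-map\<close>

definition topologically_transitive :: "'x topology \<Rightarrow> ('x \<Rightarrow> 'x) \<Rightarrow> bool" where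
  "topologically_transitive X T \<longleftrightarrow>
     (\<forall>U V. openin X U \<and> U \<noteq> {} \<and> openin X V \<and> V \<noteq> {} \<longrightarrow>
        (\<exists>n\<ge>1. (T ^^ n) ` U \<inter> V \<noteq> {}))"

definition topologically_mixing :: "'x topology \<Rightarrow> ('x \<Rightarrow> 'x) \<Rightarrow> bool" where
  "topologically_mixing X T \<longleftrightarrow>
     (\<forall>U V. openin X U \<and> U \<noteq> {} \<and> openin X V \<and> V \<noteq> {} \<longrightarrow>
        (\<exists>N. \<forall>n\<ge>N. (T ^^ n) ` U \<inter> V \<noteq> {}))"

definition periodic_elements :: "'x topology \<Rightarrow> ('x \<Rightarrow> 'x) \<Rightarrow> 'x set" where
  "periodic_elements X T = {x \<in> topspace X. \<exists>n\<ge>1. (T ^^ n) x = x}"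

definition chaotic :: "'x topology \<Rightarrow> ('x \<Rightarrow> 'x) \<Rightarrow> bool" where
  "chaotic X T \<longleftrightarrow>
     topologically_transitive X T \<and> X closure_of (periodic_elements X T) = topspace X"

definition topologically_multiply_recurrent :: "'x topology \<Rightarrow> ('x \<Rightarrow> 'x) \<Rightarrow> bool" where
  "topologically_multiply_recurrent X T \<longleftrightarrow>
     (\<forall>L\<ge>1. \<forall>U. openin X U \<and> U \<noteq> {} \<longrightarrow>
        (\<exists>n\<ge>1. U \<inter> (\<Inter>l\<in>{1..L}. (T ^^ (l * n)) -` U) \<noteq> {}))"


section \<open>The Orlicz space is a metric space, and the operator is well defined on classes\<close>

lemma young_functionD:
  assumes "young_function \<Phi>"
  shows "continuous_on UNIV \<Phi>" "\<Phi> (- t) = \<Phi> t" "convex_on UNIV \<Phi>" "\<Phi> 0 = 0"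
    "t > 0 \<Longrightarrow> \<Phi> t > 0"
  using assms by (auto simp: young_function_def)

lemma young_nonneg:
  assumes "young_function \<Phi>"
  shows "\<Phi> t \<ge> 0"
proof (cases "t \<ge> 0")
  case True
  then show ?thesis using young_functionD(4,5)[OF assms] by (cases "t = 0") (auto simp: less_imp_le)
next
  case False
  then have "\<Phi> (- t) > 0" using young_functionD(5)[OF assms] by auto
  then show ?thesis using young_functionD(2)[OF assms, of t] by simp
qed

lemma young_convex:
  assumes "young_function \<Phi>" "0 \<le> u" "u \<le> 1"
  shows "\<Phi> ((1 - u) * s + u * t) \<le> (1 - u) * \<Phi> s + u * \<Phi> t"
  using convex_onD[OF young_functionD(3)[OF assms(1)] assms(2,3), of s t] by simp

lemma young_scale:
  assumes "young_function \<Phi>" "0 \<le> u" "u \<le> 1"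
  shows "\<Phi> (u * t) \<le> u * \<Phi> t"
  using young_convex[OF assms, of 0 t] young_functionD(4)[OF assms(1)] by simp

lemma young_mono:
  assumes "young_function \<Phi>" "0 \<le> s" "s \<le> t"
  shows "\<Phi> s \<le> \<Phi> t"
proof (cases "t = 0")
  case False
  then have "\<Phi> ((s / t) * t) \<le> (s / t) * \<Phi> t"
    using assms by (intro young_scale) auto
  also have "\<dots> \<le> 1 * \<Phi> t"
    using assms False by (intro mult_right_mono young_nonneg) auto
  finally show ?thesis using False by simp
qed (use assms in auto)

lemma young_measurable:
  assumes "young_function \<Phi>"
  shows "\<Phi> \<in> borel_measurable borel"
  using young_functionD(1)[OF assms] by (rule borel_measurable_continuous_onI)

definition orlicz_modular :: "(real \<Rightarrow> real) \<Rightarrow> 'g measure \<Rightarrow> ('g \<Rightarrow> complex) \<Rightarrow> real \<Rightarrow> ennreal" where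
  "orlicz_modular \<Phi> \<mu> f k = (\<integral>\<^sup>+x. ennreal (\<Phi> (norm (f x) / k)) \<partial>\<mu>)"

lemma luxemburg_norm_modular:
  "luxemburg_norm \<Phi> \<mu> f = Inf {k. k > 0 \<and> orlicz_modular \<Phi> \<mu> f k \<le> 1}"
  by (simp add: luxemburg_norm_def orlicz_modular_def)

lemma orlicz_modular_measurable:
  assumes "young_function \<Phi>" "f \<in> borel_measurable \<mu>"
  shows "(\<lambda>x. ennreal (\<Phi> (norm (f x) / k))) \<in> borel_measurable \<mu>"
proof -
  have "(\<lambda>x. norm (f x) / k) \<in> borel_measurable \<mu>" using assms(2) by measurable
  then have "(\<lambda>x. \<Phi> (norm (f x) / k)) \<in> borel_measurable \<mu>"
    by (rule measurable_compose[OF _ young_measurable[OF assms(1)]])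
  then show ?thesis by measurable
qed

lemma orlicz_modular_AE_cong:
  assumes "AE x in \<mu>. norm (f x) = norm (g x)"
  shows "orlicz_modular \<Phi> \<mu> f k = orlicz_modular \<Phi> \<mu> g k"
  unfolding orlicz_modular_def by (rule nn_integral_cong_AE) (use assms in auto)

lemma luxemburg_norm_AE_cong:
  assumes "AE x in \<mu>. norm (f x) = norm (g x)"
  shows "luxemburg_norm \<Phi> \<mu> f = luxemburg_norm \<Phi> \<mu> g"
  unfolding luxemburg_norm_modular using orlicz_modular_AE_cong[OF assms] by simp

lemma orlicz_modular_scale:
  assumes "young_function \<Phi>" "f \<in> borel_measurable \<mu>" "0 \<le> u" "u \<le> 1"
  shows "orlicz_modular \<Phi> \<mu> f (k / u) \<le> ennreal u * orlicz_modular \<Phi> \<mu> f k"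
proof -
  have "\<Phi> (norm (f x) / (k / u)) \<le> u * \<Phi> (norm (f x) / k)" for x
    using young_scale[OF assms(1,3,4), of "norm (f x) / k"] by (simp add: mult.commute)
  then have "orlicz_modular \<Phi> \<mu> f (k / u) \<le> (\<integral>\<^sup>+x. ennreal u * ennreal (\<Phi> (norm (f x) / k)) \<partial>\<mu>)"
    unfolding orlicz_modular_def
    by (intro nn_integral_mono) (simp add: ennreal_mult'[symmetric] assms(3) ennreal_leI)
  also have "\<dots> = ennreal u * orlicz_modular \<Phi> \<mu> f k"
    unfolding orlicz_modular_def
    by (rule nn_integral_cmult) (rule orlicz_modular_measurable[OF assms(1,2)])
  finally show ?thesis .
qed

lemma orlicz_functions_iff:
  assumes "young_function \<Phi>"
  shows "f \<in> orlicz_functions \<Phi> \<mu> \<longleftrightarrow>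
    f \<in> borel_measurable \<mu> \<and> (\<exists>k>0. orlicz_modular \<Phi> \<mu> f k \<le> 1)"
proof (intro iffI conjI; (elim conjE)?)
  assume f: "f \<in> orlicz_functions \<Phi> \<mu>"
  then show m: "f \<in> borel_measurable \<mu>" by (simp add: orlicz_functions_def)
  from f obtain \<alpha> where \<alpha>: "\<alpha> > 0" "(\<integral>\<^sup>+x. ennreal (\<Phi> (\<alpha> * norm (f x))) \<partial>\<mu>) < \<infinity>"
    by (auto simp: orlicz_functions_def)
  then have fin: "orlicz_modular \<Phi> \<mu> f (1 / \<alpha>) < \<infinity>"
    by (simp add: orlicz_modular_def mult.commute)
  then obtain C where C: "C \<ge> 0" "orlicz_modular \<Phi> \<mu> f (1 / \<alpha>) = ennreal C"
    by (cases "orlicz_modular \<Phi> \<mu> f (1 / \<alpha>)") auto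
  define u where "u = 1 / (C + 1)"
  have u: "0 < u" "u \<le> 1" "u * C \<le> 1" using C by (auto simp: u_def field_simps)
  have "orlicz_modular \<Phi> \<mu> f ((1 / \<alpha>) / u) \<le> ennreal u * ennreal C"
    using orlicz_modular_scale[OF assms m, of u "1 / \<alpha>"] u C by simp
  also have "\<dots> = ennreal (u * C)" using u C by (simp add: ennreal_mult)
  also have "\<dots> \<le> 1" using u(3) by (simp add: ennreal_le_1)
  finally show "\<exists>k>0. orlicz_modular \<Phi> \<mu> f k \<le> 1"
    using \<alpha> u by (intro exI[of _ "(1 / \<alpha>) / u"]) auto
next
  assume m: "f \<in> borel_measurable \<mu>" and "\<exists>k>0. orlicz_modular \<Phi> \<mu> f k \<le> 1"
  then obtain k where k: "k > 0" "orlicz_modular \<Phi> \<mu> f k \<le> 1" by auto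
  then have "(\<integral>\<^sup>+x. ennreal (\<Phi> ((1 / k) * norm (f x))) \<partial>\<mu>) < \<infinity>"
    using order.strict_trans1[OF k(2), of \<infinity>] by (simp add: orlicz_modular_def)
  moreover have "1 / k > 0" using k by simp
  ultimately show "f \<in> orlicz_functions \<Phi> \<mu>" using m unfolding orlicz_functions_def by blast
qed

lemma luxemburg_norm_nonneg:
  assumes "young_function \<Phi>" "f \<in> orlicz_functions \<Phi> \<mu>"
  shows "luxemburg_norm \<Phi> \<mu> f \<ge> 0"
  unfolding luxemburg_norm_modular
  using assms orlicz_functions_iff[OF assms(1), of f \<mu>] by (intro cInf_greatest) auto

lemma luxemburg_norm_le:
  assumes "k > 0" "orlicz_modular \<Phi> \<mu> f k \<le> 1"
  shows "luxemburg_norm \<Phi> \<mu> f \<le> k"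
  unfolding luxemburg_norm_modular using assms
  by (intro cInf_lower bdd_belowI[of _ 0]) auto

lemma luxemburg_norm_less:
  assumes "young_function \<Phi>" "f \<in> orlicz_functions \<Phi> \<mu>" "luxemburg_norm \<Phi> \<mu> f < c"
  obtains k where "0 < k" "k < c" "orlicz_modular \<Phi> \<mu> f k \<le> 1"
proof -
  have "{k. k > 0 \<and> orlicz_modular \<Phi> \<mu> f k \<le> 1} \<noteq> {}"
    using assms orlicz_functions_iff[OF assms(1), of f \<mu>] by auto
  from cInf_lessD[OF this assms(3)[unfolded luxemburg_norm_modular]] show ?thesis
    using that by auto
qed

lemma orlicz_modular_add:
  assumes Y: "young_function \<Phi>" and f: "f \<in> borel_measurable \<mu>" and g: "g \<in> borel_measurable \<mu>"
    and k: "k > 0" "orlicz_modular \<Phi> \<mu> f k \<le> 1" and l: "l > 0" "orlicz_modular \<Phi> \<mu> g l \<le> 1"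
  shows "orlicz_modular \<Phi> \<mu> (\<lambda>x. f x + g x) (k + l) \<le> 1"
proof -
  define u where "u = l / (k + l)"
  have u: "0 \<le> u" "u \<le> 1" "1 - u = k / (k + l)" using k l by (auto simp: u_def field_simps)
  have "\<Phi> (norm (f x + g x) / (k + l)) \<le> (1 - u) * \<Phi> (norm (f x) / k) + u * \<Phi> (norm (g x) / l)" for x
  proof -
    have "norm (f x + g x) / (k + l) \<le> (norm (f x) + norm (g x)) / (k + l)"
      using k l by (intro divide_right_mono norm_triangle_ineq) auto
    also have "\<dots> = (1 - u) * (norm (f x) / k) + u * (norm (g x) / l)"
      unfolding u(3) unfolding u_def using k l by (simp add: add_divide_distrib)
    finally have "\<Phi> (norm (f x + g x) / (k + l)) \<le> \<Phi> ((1 - u) * (norm (f x) / k) + u * (norm (g x) / l))"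
      using k l by (intro young_mono[OF Y]) auto
    also have "\<dots> \<le> (1 - u) * \<Phi> (norm (f x) / k) + u * \<Phi> (norm (g x) / l)"
      by (rule young_convex[OF Y u(1,2)])
    finally show ?thesis .
  qed
  then have "ennreal (\<Phi> (norm (f x + g x) / (k + l))) \<le>
      ennreal (1 - u) * ennreal (\<Phi> (norm (f x) / k)) + ennreal u * ennreal (\<Phi> (norm (g x) / l))" for x
    using u(1,2) young_nonneg[OF Y]
    by (simp add: ennreal_mult[symmetric] ennreal_plus[symmetric] ennreal_leI del: ennreal_plus)
  then have "orlicz_modular \<Phi> \<mu> (\<lambda>x. f x + g x) (k + l) \<le>
      (\<integral>\<^sup>+x. ennreal (1 - u) * ennreal (\<Phi> (norm (f x) / k)) + ennreal u * ennreal (\<Phi> (norm (g x) / l)) \<partial>\<mu>)"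
    unfolding orlicz_modular_def by (intro nn_integral_mono)
  also have "\<dots> = ennreal (1 - u) * orlicz_modular \<Phi> \<mu> f k + ennreal u * orlicz_modular \<Phi> \<mu> g l"
    unfolding orlicz_modular_def
    using orlicz_modular_measurable[OF Y f] orlicz_modular_measurable[OF Y g]
    by (simp add: nn_integral_add nn_integral_cmult)
  also have "\<dots> \<le> ennreal (1 - u) * 1 + ennreal u * 1"
    using k l by (intro add_mono mult_left_mono) auto
  also have "\<dots> = 1" using u(1,2) by (simp flip: ennreal_plus)
  finally show ?thesis .
qed

lemma orlicz_functions_add:
  assumes "young_function \<Phi>" "f \<in> orlicz_functions \<Phi> \<mu>" "g \<in> orlicz_functions \<Phi> \<mu>"
  shows "(\<lambda>x. f x + g x) \<in> orlicz_functions \<Phi> \<mu>"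
proof -
  obtain k l where "k > 0" "orlicz_modular \<Phi> \<mu> f k \<le> 1" "l > 0" "orlicz_modular \<Phi> \<mu> g l \<le> 1"
    and m: "f \<in> borel_measurable \<mu>" "g \<in> borel_measurable \<mu>"
    using assms orlicz_functions_iff[OF assms(1)] by metis
  then have "k + l > 0" "orlicz_modular \<Phi> \<mu> (\<lambda>x. f x + g x) (k + l) \<le> 1"
    using orlicz_modular_add[OF assms(1)] by auto
  then show ?thesis using orlicz_functions_iff[OF assms(1)] m by (metis borel_measurable_add)
qed

lemma orlicz_functions_cmult:
  assumes "young_function \<Phi>" "f \<in> orlicz_functions \<Phi> \<mu>"
  shows "(\<lambda>x. c * f x) \<in> orlicz_functions \<Phi> \<mu>"
proof (cases "c = 0")
  case False
  from assms obtain \<alpha> where m: "f \<in> borel_measurable \<mu>" and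
    \<alpha>: "\<alpha> > 0" "(\<integral>\<^sup>+x. ennreal (\<Phi> (\<alpha> * norm (f x))) \<partial>\<mu>) < \<infinity>"
    by (auto simp: orlicz_functions_def)
  have "(\<integral>\<^sup>+x. ennreal (\<Phi> ((\<alpha> / norm c) * norm (c * f x))) \<partial>\<mu>) < \<infinity>"
    using \<alpha> False by (simp add: norm_mult)
  moreover have "\<alpha> / norm c > 0" using \<alpha> False by simp
  moreover have "(\<lambda>x. c * f x) \<in> borel_measurable \<mu>" using m by measurable
  ultimately show ?thesis unfolding orlicz_functions_def by blast
next
  case True
  then show ?thesis
    using young_functionD(4)[OF assms(1)] by (auto simp: orlicz_functions_def intro: exI[of _ 1])
qed

lemma orlicz_functions_diff:
  assumes "young_function \<Phi>" "f \<in> orlicz_functions \<Phi> \<mu>" "g \<in> orlicz_functions \<Phi> \<mu>"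
  shows "(\<lambda>x. f x - g x) \<in> orlicz_functions \<Phi> \<mu>"
  using orlicz_functions_add[OF assms(1,2) orlicz_functions_cmult[OF assms(1,3), of "- 1"]] by simp

lemma luxemburg_norm_triangle:
  assumes Y: "young_function \<Phi>" and f: "f \<in> orlicz_functions \<Phi> \<mu>" and g: "g \<in> orlicz_functions \<Phi> \<mu>"
  shows "luxemburg_norm \<Phi> \<mu> (\<lambda>x. f x + g x) \<le> luxemburg_norm \<Phi> \<mu> f + luxemburg_norm \<Phi> \<mu> g"
proof (rule field_le_epsilon)
  fix e :: real assume e: "e > 0"
  obtain k where k: "0 < k" "k < luxemburg_norm \<Phi> \<mu> f + e / 2" "orlicz_modular \<Phi> \<mu> f k \<le> 1"
    using luxemburg_norm_less[OF Y f, of "luxemburg_norm \<Phi> \<mu> f + e / 2"] e by auto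
  obtain l where l: "0 < l" "l < luxemburg_norm \<Phi> \<mu> g + e / 2" "orlicz_modular \<Phi> \<mu> g l \<le> 1"
    using luxemburg_norm_less[OF Y g, of "luxemburg_norm \<Phi> \<mu> g + e / 2"] e by auto
  have "orlicz_modular \<Phi> \<mu> (\<lambda>x. f x + g x) (k + l) \<le> 1"
    using f g k l by (intro orlicz_modular_add[OF Y]) (auto simp: orlicz_functions_def)
  then have "luxemburg_norm \<Phi> \<mu> (\<lambda>x. f x + g x) \<le> k + l"
    using k l by (intro luxemburg_norm_le) auto
  then show "luxemburg_norm \<Phi> \<mu> (\<lambda>x. f x + g x) \<le>
      luxemburg_norm \<Phi> \<mu> f + luxemburg_norm \<Phi> \<mu> g + e"
    using k l by simp
qed

lemma luxemburg_norm_eq_0_iff: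
  assumes Y: "young_function \<Phi>" and f: "f \<in> orlicz_functions \<Phi> \<mu>"
  shows "luxemburg_norm \<Phi> \<mu> f = 0 \<longleftrightarrow> (AE x in \<mu>. f x = 0)"
proof
  have m: "f \<in> borel_measurable \<mu>" using f by (simp add: orlicz_functions_def)
  assume 0: "luxemburg_norm \<Phi> \<mu> f = 0"
  have le: "orlicz_modular \<Phi> \<mu> f 1 \<le> ennreal e" if e: "0 < e" "e < 1" for e
  proof -
    obtain k where k: "0 < k" "k < e" "orlicz_modular \<Phi> \<mu> f k \<le> 1"
      using luxemburg_norm_less[OF Y f, of e] 0 e by auto
    have "orlicz_modular \<Phi> \<mu> f (k / k) \<le> ennreal k * orlicz_modular \<Phi> \<mu> f k"
      using k e by (intro orlicz_modular_scale[OF Y m]) auto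
    also have "\<dots> \<le> ennreal k * 1" using k by (intro mult_left_mono) auto
    also have "\<dots> \<le> ennreal e" using k by (simp add: ennreal_leI)
    finally show ?thesis using k by simp
  qed
  have "orlicz_modular \<Phi> \<mu> f 1 = 0"
  proof (cases "orlicz_modular \<Phi> \<mu> f 1")
    case (real r)
    have "r \<le> 0"
    proof (rule ccontr)
      assume "\<not> r \<le> 0"
      then have "ennreal r \<le> ennreal (min (r / 2) (1 / 2))"
        using le[of "min (r / 2) (1 / 2)"] unfolding real(2) by (simp add: min_less_iff_disj)
      then have "r \<le> min (r / 2) (1 / 2)"
        using \<open>\<not> r \<le> 0\<close> by (subst (asm) ennreal_le_iff) auto
      then show False using \<open>\<not> r \<le> 0\<close> by simp
    qed
    then show ?thesis using real by simp
  next
    case top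
    then show ?thesis using le[of "1 / 2"] by (simp add: top_unique)
  qed
  then have "AE x in \<mu>. ennreal (\<Phi> (norm (f x) / 1)) = 0"
    unfolding orlicz_modular_def
    using orlicz_modular_measurable[OF Y m, of 1] by (simp add: nn_integral_0_iff_AE)
  moreover have "z = 0" if "ennreal (\<Phi> (norm (z :: complex) / 1)) = 0" for z
    using that young_functionD(5)[OF Y, of "norm z"] by (cases "z = 0") (auto simp: ennreal_eq_0_iff)
  ultimately show "AE x in \<mu>. f x = 0" by (auto elim: eventually_mono)
next
  assume "AE x in \<mu>. f x = 0"
  then have "orlicz_modular \<Phi> \<mu> f k = orlicz_modular \<Phi> \<mu> (\<lambda>_. 0) k" for k
    by (intro orlicz_modular_AE_cong) (auto elim: eventually_mono)
  then have *: "orlicz_modular \<Phi> \<mu> f k \<le> 1" for k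
    using young_functionD(4)[OF Y] by (simp add: orlicz_modular_def)
  have "luxemburg_norm \<Phi> \<mu> f \<le> 0 + e" if "e > 0" for e
    using luxemburg_norm_le[OF that *] by simp
  then have "luxemburg_norm \<Phi> \<mu> f \<le> 0" by (rule field_le_epsilon)
  then show "luxemburg_norm \<Phi> \<mu> f = 0" using luxemburg_norm_nonneg[OF Y f] by simp
qed

lemma equiv_orlicz_rel: "equiv (orlicz_functions \<Phi> \<mu>) (orlicz_rel \<Phi> \<mu>)"
proof (rule equivI)
  show "orlicz_rel \<Phi> \<mu> \<subseteq> orlicz_functions \<Phi> \<mu> \<times> orlicz_functions \<Phi> \<mu>"
    by (auto simp: orlicz_rel_def)
  show "refl_on (orlicz_functions \<Phi> \<mu>) (orlicz_rel \<Phi> \<mu>)"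
    by (auto simp: refl_on_def orlicz_rel_def)
  show "sym (orlicz_rel \<Phi> \<mu>)"
    by (auto simp: sym_def orlicz_rel_def elim: eventually_mono)
  show "trans (orlicz_rel \<Phi> \<mu>)"
    by (auto simp: trans_def orlicz_rel_def elim: eventually_elim2)
qed

lemma orlicz_space_some:
  assumes "F \<in> orlicz_space \<Phi> \<mu>"
  shows "(SOME f. f \<in> F) \<in> F" "(SOME f. f \<in> F) \<in> orlicz_functions \<Phi> \<mu>"
proof -
  have "F \<noteq> {}" "F \<subseteq> orlicz_functions \<Phi> \<mu>"
    using assms in_quotient_imp_non_empty[OF equiv_orlicz_rel] in_quotient_imp_subset[OF equiv_orlicz_rel]
    unfolding orlicz_space_def by blast+
  then show "(SOME f. f \<in> F) \<in> F" "(SOME f. f \<in> F) \<in> orlicz_functions \<Phi> \<mu>"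
    using some_in_eq[of F] by auto
qed

lemma orlicz_space_AE:
  assumes "F \<in> orlicz_space \<Phi> \<mu>" "f \<in> F" "g \<in> F"
  shows "AE x in \<mu>. f x = g x"
  using in_quotient_imp_in_rel[OF equiv_orlicz_rel, of F \<Phi> \<mu> f g] assms
  by (simp add: orlicz_space_def orlicz_rel_def)

theorem orlicz_dist_representatives:
  assumes "F \<in> orlicz_space \<Phi> \<mu>" "G \<in> orlicz_space \<Phi> \<mu>" "f \<in> F" "g \<in> G"
  shows "orlicz_dist \<Phi> \<mu> F G = luxemburg_norm \<Phi> \<mu> (\<lambda>x. f x - g x)"
proof -
  have "AE x in \<mu>. (SOME f. f \<in> F) x = f x" "AE x in \<mu>. (SOME g. g \<in> G) x = g x"
    using orlicz_space_AE orlicz_space_some(1) assms by blast+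
  then have "luxemburg_norm \<Phi> \<mu> (\<lambda>x. (SOME f. f \<in> F) x - (SOME g. g \<in> G) x) =
      luxemburg_norm \<Phi> \<mu> (\<lambda>x. f x - g x)"
    by (intro luxemburg_norm_AE_cong) (auto elim: eventually_elim2)
  then show ?thesis using assms by (simp add: orlicz_dist_def)
qed

theorem Metric_space_orlicz:
  assumes Y: "young_function \<Phi>"
  shows "Metric_space (orlicz_space \<Phi> \<mu>) (orlicz_dist \<Phi> \<mu>)"
proof
  fix F G :: "('a \<Rightarrow> complex) set"
  show "0 \<le> orlicz_dist \<Phi> \<mu> F G"
    by (auto simp: orlicz_dist_def intro!: luxemburg_norm_nonneg[OF Y] orlicz_functions_diff[OF Y]
        orlicz_space_some)
  show "orlicz_dist \<Phi> \<mu> F G = orlicz_dist \<Phi> \<mu> G F"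
    by (auto simp: orlicz_dist_def norm_minus_commute intro!: luxemburg_norm_AE_cong)
next
  fix F G
  assume F: "F \<in> orlicz_space \<Phi> \<mu>" and G: "G \<in> orlicz_space \<Phi> \<mu>"
  define f where "f = (SOME f. f \<in> F)"
  define g where "g = (SOME g. g \<in> G)"
  have f: "f \<in> F" "f \<in> orlicz_functions \<Phi> \<mu>" and g: "g \<in> G" "g \<in> orlicz_functions \<Phi> \<mu>"
    unfolding f_def g_def using orlicz_space_some F G by blast+
  have "orlicz_dist \<Phi> \<mu> F G = 0 \<longleftrightarrow> (AE x in \<mu>. f x - g x = 0)"
    using orlicz_dist_representatives[OF F G f(1) g(1)]
      luxemburg_norm_eq_0_iff[OF Y orlicz_functions_diff[OF Y f(2) g(2)]] by simp
  also have "\<dots> \<longleftrightarrow> (f, g) \<in> orlicz_rel \<Phi> \<mu>" using f g by (simp add: orlicz_rel_def)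
  also have "\<dots> \<longleftrightarrow> F = G"
    using quotient_eq_iff[OF equiv_orlicz_rel F[unfolded orlicz_space_def]
        G[unfolded orlicz_space_def] f(1) g(1)] by simp
  finally show "orlicz_dist \<Phi> \<mu> F G = 0 \<longleftrightarrow> F = G" .
next
  fix F G H
  assume F: "F \<in> orlicz_space \<Phi> \<mu>" and G: "G \<in> orlicz_space \<Phi> \<mu>" and H: "H \<in> orlicz_space \<Phi> \<mu>"
  define f where "f = (SOME f. f \<in> F)"
  define g where "g = (SOME g. g \<in> G)"
  define h where "h = (SOME h. h \<in> H)"
  have f: "f \<in> F" "f \<in> orlicz_functions \<Phi> \<mu>" and g: "g \<in> G" "g \<in> orlicz_functions \<Phi> \<mu>"
    and h: "h \<in> H" "h \<in> orlicz_functions \<Phi> \<mu>"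
    unfolding f_def g_def h_def using orlicz_space_some F G H by blast+
  show "orlicz_dist \<Phi> \<mu> F H \<le> orlicz_dist \<Phi> \<mu> F G + orlicz_dist \<Phi> \<mu> G H"
    using luxemburg_norm_triangle[OF Y orlicz_functions_diff[OF Y f(2) g(2)]
        orlicz_functions_diff[OF Y g(2) h(2)]]
    by (simp add: orlicz_dist_representatives[OF F G f(1) g(1)]
        orlicz_dist_representatives[OF F H f(1) h(1)] orlicz_dist_representatives[OF G H g(1) h(1)])
qed

lemma right_haar_measure_distr:
  fixes \<mu> :: "'g::{topological_group_add, t2_space} measure"
  assumes "right_haar_measure \<mu>"
  shows "distr \<mu> \<mu> (\<lambda>x. x - a) = \<mu>" "(\<lambda>x. x - a) \<in> measurable \<mu> \<mu>"
proof -
  have s: "sets \<mu> = sets borel" using assms by (simp add: right_haar_measure_def)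
  have "continuous_on UNIV (\<lambda>x::'g. x - a)" by (intro continuous_intros)
  then have "(\<lambda>x. x - a) \<in> borel_measurable (borel :: 'g measure)"
    by (rule borel_measurable_continuous_onI)
  then show m: "(\<lambda>x. x - a) \<in> measurable \<mu> \<mu>"
    by (simp add: measurable_cong_sets[OF s s])
  have sp: "space \<mu> = UNIV" using sets_eq_imp_space_eq[OF s] by simp
  show "distr \<mu> \<mu> (\<lambda>x. x - a) = \<mu>"
  proof (rule measure_eqI)
    fix A assume "A \<in> sets (distr \<mu> \<mu> (\<lambda>x. x - a))"
    then have A: "A \<in> sets \<mu>" by simp
    have "(\<lambda>x. x - a) -` A = (\<lambda>x. x + a) ` A"
      by (auto simp: image_iff) (metis diff_add_cancel)
    then show "emeasure (distr \<mu> \<mu> (\<lambda>x. x - a)) A = emeasure \<mu> A"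
      using assms A s by (simp add: emeasure_distr[OF m A] sp right_haar_measure_def)
  qed simp
qed

lemma weighted_shift_orlicz:
  fixes \<mu> :: "'g::{topological_group_add, t2_space} measure"
  assumes \<mu>: "right_haar_measure \<mu>" and w: "weight w" and Y: "young_function \<Phi>"
    and f: "f \<in> orlicz_functions \<Phi> \<mu>"
  shows "weighted_shift a w f \<in> orlicz_functions \<Phi> \<mu>"
proof -
  have s: "sets \<mu> = sets borel" using \<mu> by (simp add: right_haar_measure_def)
  have fm: "f \<in> borel_measurable \<mu>" using f by (simp add: orlicz_functions_def)
  from w have "w \<in> borel_measurable borel"
    unfolding weight_def by (intro borel_measurable_continuous_onI) auto
  then have wm: "w \<in> borel_measurable \<mu>" using measurable_cong_sets[OF s refl] by blast
  have "(\<lambda>x. f (x - a)) \<in> borel_measurable \<mu>"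
    using right_haar_measure_distr(2)[OF \<mu>] fm by (rule measurable_compose)
  then have m: "weighted_shift a w f \<in> borel_measurable \<mu>"
    unfolding weighted_shift_def using wm by measurable
  obtain B where B: "B > 0" "\<And>x. \<bar>w x\<bar> \<le> B"
    using w by (auto simp: weight_def bounded_pos)
  obtain k where k: "k > 0" "orlicz_modular \<Phi> \<mu> f k \<le> 1"
    using f orlicz_functions_iff[OF Y] by auto
  have "\<Phi> (norm (weighted_shift a w f x) / (B * k)) \<le> \<Phi> (norm (f (x - a)) / k)" for x
  proof (rule young_mono[OF Y])
    have "norm (weighted_shift a w f x) \<le> B * norm (f (x - a))"
      using B(2)[of x] by (simp add: weighted_shift_def norm_mult mult_right_mono)
    then show "norm (weighted_shift a w f x) / (B * k) \<le> norm (f (x - a)) / k"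
      using B(1) k by (simp add: field_simps)
  qed (use B k in auto)
  then have "orlicz_modular \<Phi> \<mu> (weighted_shift a w f) (B * k) \<le>
      (\<integral>\<^sup>+x. ennreal (\<Phi> (norm (f (x - a)) / k)) \<partial>\<mu>)"
    unfolding orlicz_modular_def by (intro nn_integral_mono ennreal_leI)
  also have "\<dots> = (\<integral>\<^sup>+x. ennreal (\<Phi> (norm (f x) / k)) \<partial>(distr \<mu> \<mu> (\<lambda>x. x - a)))"
    using orlicz_modular_measurable[OF Y fm, of k] right_haar_measure_distr(2)[OF \<mu>, of a]
    by (subst nn_integral_distr) auto
  also have "\<dots> = orlicz_modular \<Phi> \<mu> f k"
    by (simp add: right_haar_measure_distr(1)[OF \<mu>] orlicz_modular_def)
  also have "\<dots> \<le> 1" by (rule k(2))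
  finally show ?thesis
    using orlicz_functions_iff[OF Y] m B k by (metis mult_pos_pos)
qed

lemma weighted_shift_AE_cong:
  fixes \<mu> :: "'g::{topological_group_add, t2_space} measure"
  assumes \<mu>: "right_haar_measure \<mu>" and "AE x in \<mu>. f x = g x"
  shows "AE x in \<mu>. weighted_shift a w f x = weighted_shift a w g x"
proof -
  have "AE x in distr \<mu> \<mu> (\<lambda>x. x - a). f x = g x"
    unfolding right_haar_measure_distr(1)[OF \<mu>] by (rule assms(2))
  then have "AE x in \<mu>. f (x - a) = g (x - a)"
    by (rule AE_distrD[OF right_haar_measure_distr(2)[OF \<mu>]])
  then show ?thesis by (auto simp: weighted_shift_def elim: eventually_mono)
qed

theorem weighted_translation_class:
  fixes \<mu> :: "'g::{topological_group_add, t2_space} measure"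
  assumes \<mu>: "right_haar_measure \<mu>" and w: "weight w" and Y: "young_function \<Phi>"
    and f: "f \<in> orlicz_functions \<Phi> \<mu>"
  shows "weighted_translation \<Phi> \<mu> a w (orlicz_rel \<Phi> \<mu> `` {f}) =
    orlicz_rel \<Phi> \<mu> `` {weighted_shift a w f}"
proof -
  have "(\<lambda>f. orlicz_rel \<Phi> \<mu> `` {weighted_shift a w f}) respects orlicz_rel \<Phi> \<mu>"
  proof (rule congruentI)
    fix g h assume "(g, h) \<in> orlicz_rel \<Phi> \<mu>"
    then have "(weighted_shift a w g, weighted_shift a w h) \<in> orlicz_rel \<Phi> \<mu>"
      using weighted_shift_orlicz[OF \<mu> w Y] weighted_shift_AE_cong[OF \<mu>]
      by (auto simp: orlicz_rel_def)
    then show "orlicz_rel \<Phi> \<mu> `` {weighted_shift a w g} = orlicz_rel \<Phi> \<mu> `` {weighted_shift a w h}"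
      by (rule equiv_class_eq[OF equiv_orlicz_rel])
  qed
  then show ?thesis
    unfolding weighted_translation_def by (rule UN_equiv_class[OF equiv_orlicz_rel _ f])
qed

end

theory Submission
  imports Defs
begin

text \<open>
  A chaotic map is multiply recurrent because every nonempty open set contains a periodic point.

  For a mixing \<open>T\<close>, the powers are \<open>T\<^sup>n f (x) = W\<^sub>n(x) f(x - n a)\<close> with a cocycle \<open>W\<^sub>n\<close>.  An aperiodic
  \<open>a\<close> moves every compact set \<open>K\<close> off itself, so returning to a neighbourhood of the indicator of \<open>K\<close>
  at all large times forces, for all large \<open>n\<close>, that \<open>W\<^sub>n(x)\<close> is large and \<open>W\<^sub>n(x + n a)\<close> is small
  for most \<open>x \<in> K\<close>.  Applied simultaneously to \<open>n, 2n, \<dots>, Ln\<close>, this makes \<open>T\<^sup>m\<^sup>n\<close> and its inverse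
  small on functions living on most of \<open>K\<close>, which by the \<open>\<Delta>\<^sub>2\<close>-condition approximate everything.
\<close>

section \<open>Aperiodic elements\<close>

text \<open>The power \<open>a^n\<close> of multiplicative notation; the additively written group
  may be noncommutative, so the order of summands matters throughout.\<close>

primrec nmult :: "nat \<Rightarrow> 'a::monoid_add \<Rightarrow> 'a" where
  "nmult 0 a = 0"
| "nmult (Suc n) a = a + nmult n a"

lemma nmult_add: "nmult (m + n) a = nmult m a + nmult n a"
  by (induction m) (auto simp: add.assoc)

lemma nmult_Suc': "nmult (Suc n) a = nmult n a + a"
  using nmult_add[of n 1 a] by simp

lemma diff_nmult:
  fixes x a :: "'a::group_add"
  assumes "n \<le> m"
  shows "x - nmult m a + nmult n a = x - nmult (m - n) a"
proof -
  have "nmult m a = nmult n a + nmult (m - n) a"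
    using assms by (simp flip: nmult_add)
  then show ?thesis by (simp add: diff_add_eq_diff_diff_swap)
qed

lemma minus_nmult_add:
  fixes a :: "'a::group_add"
  assumes "n \<le> m"
  shows "- nmult n a + nmult m a = nmult (m - n) a"
proof -
  have "nmult m a = nmult n a + nmult (m - n) a"
    using assms by (simp flip: nmult_add)
  then show ?thesis by (simp flip: add.assoc)
qed

lemma open_translates:
  fixes U :: "'a::topological_group_add set"
  assumes "open U"
  shows "open {y. g + y \<in> U}" "open {y. y + g \<in> U}" "open {y. g - y \<in> U}"
proof -
  have "continuous_on UNIV (\<lambda>y::'a. g + y)" "continuous_on UNIV (\<lambda>y::'a. y + g)"
    "continuous_on UNIV (\<lambda>y::'a. g + - y)"
    by (intro continuous_intros)+
  then show "open {y. g + y \<in> U}" "open {y. y + g \<in> U}" "open {y. g - y \<in> U}"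
    using open_vimage[OF assms] unfolding vimage_def by simp_all
qed

lemma compact_translate:
  fixes K :: "'a::topological_group_add set"
  assumes "compact K"
  shows "compact ((\<lambda>y. y + g) ` K)"
  by (intro compact_continuous_image continuous_intros assms)

text \<open>A sequence of multiples of \<open>a\<close> inside the compact set has a convergent
  subsequence, and the difference of two late terms is again a multiple of \<open>a\<close>, close
  to \<open>0\<close>. First countability turns compactness into sequential compactness.\<close>

lemma nmult_return_zero:
  fixes a :: "'g::{topological_group_add, first_countable_topology}"
  assumes C: "compact C" and inf: "infinite {n. nmult n a \<in> C}"
    and V: "open V" "0 \<in> V"
  shows "\<exists>n\<ge>N. nmult n a \<in> V"
proof -
  define \<sigma> where "\<sigma> = enumerate {n. nmult n a \<in> C}"
  have \<sigma>: "strict_mono \<sigma>" "\<And>i. nmult (\<sigma> i) a \<in> C"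
    unfolding \<sigma>_def using strict_mono_enumerate[OF inf] enumerate_in_set[OF inf] by auto
  obtain c r where r: "strict_mono r" and lim: "((\<lambda>i. nmult (\<sigma> i) a) \<circ> r) \<longlonglongrightarrow> c"
    using compact_imp_seq_compact[OF C] \<sigma>(2) unfolding seq_compact_def by metis
  define \<tau> where "\<tau> = \<sigma> \<circ> r"
  have \<tau>: "strict_mono \<tau>" using \<sigma>(1) r unfolding \<tau>_def by (rule strict_mono_o)
  have lim: "(\<lambda>i. nmult (\<tau> i) a) \<longlonglongrightarrow> c" using lim by (simp add: \<tau>_def o_def)
  \<comment> \<open>Two successive limits replace a Cauchy argument: first fix \<open>i\<close> with
    \<open>- nmult (\<tau> i) a + c\<close> in \<open>V\<close>, then let the second index tend to
    infinity inside the open set \<open>V\<close>.\<close>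
  have "(\<lambda>i. - nmult (\<tau> i) a + c) \<longlonglongrightarrow> - c + c" by (intro tendsto_intros lim)
  then have "(\<lambda>i. - nmult (\<tau> i) a + c) \<longlonglongrightarrow> 0" by simp
  from topological_tendstoD[OF this V] obtain i where i: "- nmult (\<tau> i) a + c \<in> V"
    by (auto simp: eventually_sequentially)
  have "(\<lambda>j. - nmult (\<tau> i) a + nmult (\<tau> j) a) \<longlonglongrightarrow> - nmult (\<tau> i) a + c"
    by (intro tendsto_intros lim)
  from topological_tendstoD[OF this V(1) i] obtain J
    where J: "\<And>j. j \<ge> J \<Longrightarrow> - nmult (\<tau> i) a + nmult (\<tau> j) a \<in> V"
    by (auto simp: eventually_sequentially)
  \<comment> \<open>The summand \<open>\<tau> i + N\<close> makes the natural number difference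
    \<open>\<tau> j - \<tau> i\<close> untruncated and at least \<open>N\<close>.\<close>
  define j where "j = max J (\<tau> i + N)"
  have "\<tau> j \<ge> j" using \<tau> by (rule strict_mono_imp_increasing)
  then have "\<tau> j - \<tau> i \<ge> N" "\<tau> i \<le> \<tau> j" by (auto simp: j_def)
  moreover from this have "nmult (\<tau> j - \<tau> i) a \<in> V"
    using J[of j] by (simp add: minus_nmult_add j_def)
  ultimately show ?thesis by blast
qed

lemma continuous_image_closure_subset:
  assumes "continuous_on UNIV f" "f ` S \<subseteq> closure T"
  shows "f ` closure S \<subseteq> closure T"
  using assms image_closure_subset[of S f "closure T"] continuous_on_subset by blast

text \<open>If the multiples of \<open>a\<close> return to every neighbourhood of \<open>0\<close>, then the closure of the
  forward orbit is already a group, and finitely many translates of a compact neighbourhood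
  of \<open>0\<close> cover it: the first return time to the neighbourhood is bounded.\<close>

lemma compact_closed_subgroup_generated:
  fixes a :: "'g::{topological_group_add, t2_space}"
  assumes lc: "locally_compact_space (euclidean :: 'g topology)"
    and ret: "\<And>V N. open V \<Longrightarrow> 0 \<in> V \<Longrightarrow> \<exists>n\<ge>N. nmult n a \<in> V"
  shows "compact (closed_subgroup_generated a)"
proof -
  define P where "P = range (\<lambda>n. nmult n a)"
  define H where "H = closure P"
  \<comment> \<open>Density of \<open>P\<close> in \<open>H\<close> may only supply the multiple
    \<open>0\<close>; adding one positive return near \<open>0\<close> makes the multiple
    positive.\<close>
  have dense: "\<exists>k\<ge>1. nmult k a \<in> U" if U: "open U" "h \<in> U" "h \<in> H" for U h
  proof -
    from U obtain n where n: "nmult n a \<in> U"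
      using open_Int_closure_eq_empty[of U P] unfolding H_def P_def by blast
    obtain m where "m \<ge> 1" "nmult n a + nmult m a \<in> U"
      using ret[OF open_translates(1)[OF U(1), of "nmult n a"], of 1] n by auto
    then show ?thesis by (intro exI[of _ "n + m"]) (auto simp: nmult_add)
  qed
  \<comment> \<open>If \<open>nmult n a\<close> is close to \<open>0\<close> and
    \<open>n \<ge> k\<close>, then \<open>nmult (n - k) a\<close> is close to
    \<open>- nmult k a\<close>, so inverses are limits of the forward orbit.\<close>
  have neg: "- nmult k a \<in> H" for k
  proof -
    have "\<exists>y\<in>P. y \<in> U" if U: "open U" "- nmult k a \<in> U" for U
    proof -
      obtain n where "n \<ge> k" "- nmult k a + nmult n a \<in> U"
        using ret[OF open_translates(1)[OF U(1), of "- nmult k a"], of k] U by auto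
      then show ?thesis by (auto simp: minus_nmult_add P_def)
    qed
    then show ?thesis
      unfolding H_def closure_iff_nhds_not_empty by (meson disjoint_iff open_subset subset_iff)
  qed
  \<comment> \<open>Closure under addition passes to \<open>H\<close> one argument at a time, by
    continuity of left and then of right translations.\<close>
  have PP: "x + y \<in> P" if "x \<in> P" "y \<in> P" for x y
    using that unfolding P_def by (auto simp flip: nmult_add)
  have PH: "x + y \<in> H" if "x \<in> P" "y \<in> H" for x y
  proof -
    have "(\<lambda>y. x + y) ` closure P \<subseteq> closure P"
      using PP[OF that(1)] closure_subset
      by (intro continuous_image_closure_subset continuous_intros) blast
    then show ?thesis using that unfolding H_def by blast
  qed
  have HH: "x + y \<in> H" if "x \<in> H" "y \<in> H" for x y
  proof -
    have "(\<lambda>x. x + y) ` closure P \<subseteq> closure P"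
      using PH[OF _ that(2)] unfolding H_def
      by (intro continuous_image_closure_subset continuous_intros) blast
    then show ?thesis using that unfolding H_def by blast
  qed
  have Hneg: "- x \<in> H" if "x \<in> H" for x
  proof -
    have "uminus ` closure P \<subseteq> closure P"
      using neg unfolding H_def P_def
      by (intro continuous_image_closure_subset continuous_intros) blast
    then show ?thesis using that unfolding H_def by blast
  qed
  have aH: "nmult n a \<in> H" for n
    unfolding H_def P_def using closure_subset by fastforce
  have "is_subgroup H"
    using HH Hneg aH[of 0] by (simp add: is_subgroup_def)
  moreover have "closed H" by (simp add: H_def)
  moreover have "a \<in> H" using aH[of 1] by simp
  ultimately have sub: "closed_subgroup_generated a \<subseteq> H"
    unfolding closed_subgroup_generated_def by (intro hull_minimal) auto
  obtain V C :: "'g set" where V: "open V" "0 \<in> V" "V \<subseteq> C" and C: "compact C"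
    using bspec[OF lc[unfolded locally_compact_space_def], of 0] by auto
  have D: "compact (C \<inter> H)" using C \<open>closed H\<close> by (rule compact_Int_closed)
  \<comment> \<open>A positive multiple of \<open>a\<close> close to \<open>- h\<close> carries
    \<open>h\<close> into \<open>V\<close>; compactness then leaves finitely many step
    lengths.\<close>
  have "C \<inter> H \<subseteq> (\<Union>j\<in>{1..}. {x. x + nmult j a \<in> V})"
  proof
    fix h assume "h \<in> C \<inter> H"
    then have "- h \<in> H" using Hneg by blast
    then obtain k where "k \<ge> 1" "h + nmult k a \<in> V"
      using dense[OF open_translates(1)[OF V(1), of h], of "- h"] V(2) by auto
    then show "h \<in> (\<Union>j\<in>{1..}. {x. x + nmult j a \<in> V})" by auto
  qed
  then obtain J where J: "J \<subseteq> {1..}" "finite J" "C \<inter> H \<subseteq> (\<Union>j\<in>J. {x. x + nmult j a \<in> V})"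
    using compactE_image[OF D, of "{1..}" "\<lambda>j. {x. x + nmult j a \<in> V}"] open_translates(2)[OF V(1)]
    by metis
  have "H \<subseteq> (\<Union>k\<in>{..Max J}. (\<lambda>y. y + nmult k a) ` C)"
  proof
    fix h assume h: "h \<in> H"
    \<comment> \<open>The first backward return \<open>k\<close> of \<open>h\<close> to
      \<open>V\<close> is bounded by \<open>Max J\<close>: from \<open>h - nmult k a\<close>, a
      point of \<open>C \<inter> H\<close>, some forward step \<open>j \<in> J\<close> leads into
      \<open>V\<close> again, and \<open>j < k\<close> would make \<open>k - j\<close> an earlier
      return.\<close>
    define k where "k = (LEAST k. k \<ge> 1 \<and> h - nmult k a \<in> V)"
    have ex: "\<exists>k\<ge>1. h - nmult k a \<in> V"
      using dense[OF open_translates(3)[OF V(1), of h], of h] V(2) h by auto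
    then have k: "k \<ge> 1" "h - nmult k a \<in> V"
      using LeastI_ex[OF ex] unfolding k_def by auto
    have "h - nmult k a \<in> C \<inter> H"
      using k V(3) HH[OF h Hneg[OF aH]] by auto
    then obtain j where j: "j \<in> J" "h - nmult k a + nmult j a \<in> V" using J(3) by blast
    have "k \<le> j"
    proof (rule ccontr)
      assume "\<not> k \<le> j"
      then have "h - nmult (k - j) a \<in> V" "k - j \<ge> 1" "k - j < k"
        using j diff_nmult[of j k h a] J(1) by auto
      then show False
        using not_less_Least[of "k - j" "\<lambda>k. k \<ge> 1 \<and> h - nmult k a \<in> V"] unfolding k_def by blast
    qed
    then have "k \<le> Max J" using Max_ge[OF J(2) j(1)] by linarith
    moreover have "h = (h - nmult k a) + nmult k a" "h - nmult k a \<in> C" using k V(3) by auto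
    ultimately show "h \<in> (\<Union>k\<in>{..Max J}. (\<lambda>y. y + nmult k a) ` C)" by blast
  qed
  moreover have "compact (\<Union>k\<in>{..Max J}. (\<lambda>y. y + nmult k a) ` C)"
    by (intro compact_UN compact_translate C) auto
  ultimately have "compact H"
    using \<open>closed H\<close> compact_Int_closed by (metis inf.absorb_iff2)
  moreover have "closed (closed_subgroup_generated a)"
    unfolding closed_subgroup_generated_def hull_def by (intro closed_Inter) auto
  ultimately show ?thesis
    using sub compact_Int_closed by (metis inf.absorb_iff2)
qed

text \<open>Either kind of intersection puts \<open>nmult n a\<close> into the compact set
  \<open>- K + K\<close>. Infinitely many such \<open>n\<close> would give returns to every
  neighbourhood of \<open>0\<close>, hence a compact closed subgroup.\<close>

lemma aperiodic_eventually_disjoint: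
  fixes a :: "'g::{topological_group_add, t2_space, first_countable_topology}"
  assumes lc: "locally_compact_space (euclidean :: 'g topology)" and ap: "aperiodic a"
    and K: "compact K"
  obtains N0 where "\<And>n x. n \<ge> N0 \<Longrightarrow> x \<in> K \<Longrightarrow> x + nmult n a \<notin> K \<and> x - nmult n a \<notin> K"
proof -
  define C where "C = (\<lambda>(x, y). - x + y) ` (K \<times> K)"
  have C: "compact C"
    unfolding C_def split_def by (intro compact_continuous_image compact_Times K continuous_intros)
  have "finite {n. nmult n a \<in> C}"
    using compact_closed_subgroup_generated[OF lc nmult_return_zero[OF C]] ap
    unfolding aperiodic_def by blast
  then obtain N0 where N0: "\<And>n. nmult n a \<in> C \<Longrightarrow> n < N0"
    using finite_nat_bounded by blast
  show ?thesis
  proof (rule that[of N0])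
    fix n x assume n: "n \<ge> N0" and x: "x \<in> K"
    have notC: "nmult n a \<notin> C" using N0[of n] n by auto
    show "x + nmult n a \<notin> K \<and> x - nmult n a \<notin> K"
    proof (intro conjI notI)
      assume "x + nmult n a \<in> K"
      then have "nmult n a \<in> C" unfolding C_def using x
        by (intro image_eqI[of _ _ "(x, x + nmult n a)"]) (auto simp flip: add.assoc)
      then show False using notC by simp
    next
      assume "x - nmult n a \<in> K"
      then have "nmult n a \<in> C" unfolding C_def using x
        by (intro image_eqI[of _ _ "(x - nmult n a, x)"]) auto
      then show False using notC by simp
    qed
  qed
qed

section \<open>Orlicz functions\<close>

lemma orlicz_modular_mono:
  assumes "young_function \<Phi>" "0 < l" "l \<le> k"
  shows "orlicz_modular \<Phi> \<mu> f k \<le> orlicz_modular \<Phi> \<mu> f l"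
  unfolding orlicz_modular_def
  by (intro nn_integral_mono ennreal_leI young_mono[OF assms(1)] divide_left_mono)
    (use assms in auto)

text \<open>Halving the scale costs at most a factor \<open>M\<close>, and finitely many halvings
  bring an admissible scale \<open>l\<close> below \<open>k\<close>.\<close>

lemma orlicz_modular_finite:
  assumes Y: "young_function \<Phi>" and f: "f \<in> orlicz_functions \<Phi> \<mu>"
    and M: "M > 0" "\<And>t. t > 0 \<Longrightarrow> \<Phi> (2 * t) \<le> M * \<Phi> t" and k: "k > 0"
  shows "orlicz_modular \<Phi> \<mu> f k < \<infinity>"
proof -
  have fm: "f \<in> borel_measurable \<mu>" using f by (simp add: orlicz_functions_def)
  obtain l where l: "l > 0" "orlicz_modular \<Phi> \<mu> f l \<le> 1"
    using f orlicz_functions_iff[OF Y] by auto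
  have halve: "orlicz_modular \<Phi> \<mu> f (l / 2 ^ n) < \<infinity>" for n
  proof (induction n)
    case 0
    then show ?case using order.strict_trans1[OF l(2), of \<infinity>] by simp
  next
    case (Suc n)
    have "\<Phi> (norm (f x) / (l / 2 ^ Suc n)) \<le> M * \<Phi> (norm (f x) / (l / 2 ^ n))" for x
      using M(2)[of "norm (f x) / (l / 2 ^ n)"] l young_functionD(4)[OF Y]
      by (cases "f x = 0") (auto simp: field_simps)
    then have "orlicz_modular \<Phi> \<mu> f (l / 2 ^ Suc n) \<le>
        (\<integral>\<^sup>+x. ennreal M * ennreal (\<Phi> (norm (f x) / (l / 2 ^ n))) \<partial>\<mu>)"
      unfolding orlicz_modular_def using M(1)
      by (intro nn_integral_mono) (auto simp: ennreal_mult'[symmetric] intro!: ennreal_leI)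
    also have "\<dots> = ennreal M * orlicz_modular \<Phi> \<mu> f (l / 2 ^ n)"
      unfolding orlicz_modular_def
      by (rule nn_integral_cmult) (rule orlicz_modular_measurable[OF Y fm])
    also have "\<dots> < \<infinity>" using Suc by (simp add: ennreal_mult_less_top)
    finally show ?case .
  qed
  obtain n where "l / k < 2 ^ n" using real_arch_pow[of 2 "l / k"] by auto
  then have "l / 2 ^ n \<le> k" using k by (simp add: field_simps)
  then have "orlicz_modular \<Phi> \<mu> f k \<le> orlicz_modular \<Phi> \<mu> f (l / 2 ^ n)"
    using l by (intro orlicz_modular_mono[OF Y]) auto
  then show ?thesis using halve[of n] by (rule order.strict_trans1)
qed

text \<open>The Lindelof property gives countably many relatively compact open sets covering the
  space; finite unions of compact sets containing them form the increasing sequence.\<close>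

lemma compact_exhaustion:
  assumes "locally_compact_space (euclidean :: 'g topology)"
  obtains K :: "nat \<Rightarrow> ('g::second_countable_topology) set" where "\<And>i. compact (K i)" "incseq K" "(\<Union>i. K i) = UNIV"
proof -
  define F where "F = {U :: 'g set. open U \<and> (\<exists>C. compact C \<and> U \<subseteq> C)}"
  have "\<Union>F = UNIV"
  proof (intro equalityI subset_UNIV subsetI)
    fix x :: 'g
    obtain U C where "open U" "compact C" "x \<in> U" "U \<subseteq> C"
      using bspec[OF assms[unfolded locally_compact_space_def], of x] by auto
    then show "x \<in> \<Union>F" unfolding F_def by blast
  qed
  moreover obtain F' where F': "F' \<subseteq> F" "countable F'" "\<Union>F' = \<Union>F"
    using Lindelof[of F] unfolding F_def by blast
  ultimately have ne: "F' \<noteq> {}" by auto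
  have "\<forall>U\<in>F'. \<exists>C. compact C \<and> U \<subseteq> C" using F' unfolding F_def by blast
  then obtain C where C: "\<And>U. U \<in> F' \<Longrightarrow> compact (C U) \<and> U \<subseteq> C U" by metis
  define K where "K i = (\<Union>j\<le>i. C (from_nat_into F' j))" for i
  have mem: "from_nat_into F' j \<in> F'" for j using from_nat_into[OF ne] .
  show ?thesis
  proof (rule that[of K])
    show "compact (K i)" for i unfolding K_def using C mem by (intro compact_UN) auto
    show "incseq K" unfolding K_def by (intro incseq_SucI UN_mono) auto
    show "(\<Union>i. K i) = UNIV"
    proof (intro equalityI subset_UNIV subsetI)
      fix x :: 'g
      have "x \<in> \<Union>F'" by (simp add: F'(3) \<open>\<Union>F = UNIV\<close>)
      then obtain U where "U \<in> F'" "x \<in> U" by (rule UnionE)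
      moreover from this obtain j where "U = from_nat_into F' j"
        using from_nat_into_surj[OF F'(2)] by metis
      ultimately show "x \<in> (\<Union>i. K i)" unfolding K_def using C[of U] by blast
    qed
  qed
qed

lemma orlicz_functions_indicator_compact:
  assumes "young_function \<Phi>" and \<mu>: "right_haar_measure \<mu>" and K: "compact K"
  shows "(indicator K :: _ \<Rightarrow> complex) \<in> orlicz_functions \<Phi> \<mu>"
proof -
  have s: "sets \<mu> = sets borel" and fin: "emeasure \<mu> K < \<infinity>"
    using \<mu> K by (auto simp: right_haar_measure_def)
  have Ks: "K \<in> sets \<mu>" unfolding s using compact_imp_closed[OF K] by (rule borel_closed)
  have "(\<integral>\<^sup>+x. ennreal (\<Phi> (1 * norm (indicator K x :: complex))) \<partial>\<mu>) =
      (\<integral>\<^sup>+x. ennreal (\<Phi> 1) * indicator K x \<partial>\<mu>)"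
    using young_functionD(4)[OF assms(1)]
    by (intro nn_integral_cong) (auto simp: indicator_def)
  also have "\<dots> = ennreal (\<Phi> 1) * emeasure \<mu> K"
    using Ks by (rule nn_integral_cmult_indicator)
  also have "\<dots> < \<infinity>" using fin by (simp add: ennreal_mult_less_top)
  finally have "\<exists>\<alpha>>0. (\<integral>\<^sup>+x. ennreal (\<Phi> (\<alpha> * norm (indicator K x :: complex))) \<partial>\<mu>) < \<infinity>"
    by (intro exI[of _ 1]) auto
  then show ?thesis
    using Ks unfolding orlicz_functions_def by (simp add: borel_measurable_indicator)
qed

text \<open>Order continuity of the norm, a consequence of the \<open>\<Delta>\<^sub>2\<close>-condition.\<close>

lemma orlicz_truncation:
  fixes \<mu> :: "'g::{topological_group_add, t2_space, second_countable_topology} measure"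
  assumes lc: "locally_compact_space (euclidean :: 'g topology)"
    and \<mu>: "right_haar_measure \<mu>" and Y: "young_function \<Phi>"
    and M: "M > 0" "\<And>t. t > 0 \<Longrightarrow> \<Phi> (2 * t) \<le> M * \<Phi> t"
    and f: "f \<in> orlicz_functions \<Phi> \<mu>" and \<epsilon>: "\<epsilon> > 0"
  obtains K \<delta> where "compact K" "\<delta> > 0"
    "\<And>E. E \<in> sets \<mu> \<Longrightarrow> emeasure \<mu> (K - E) \<le> ennreal \<delta> \<Longrightarrow>
       luxemburg_norm \<Phi> \<mu> (\<lambda>x. f x - indicator E x * f x) \<le> \<epsilon>"
proof -
  have s: "sets \<mu> = sets borel" using \<mu> by (auto simp: right_haar_measure_def)
  then have sp: "space \<mu> = UNIV" using sets_eq_imp_space_eq by fastforce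
  have fm: "f \<in> borel_measurable \<mu>" using f by (simp add: orlicz_functions_def)
  define p where "p x = ennreal (\<Phi> (norm (f x) / \<epsilon>))" for x
  have pm: "p \<in> borel_measurable \<mu>"
    unfolding p_def by (rule orlicz_modular_measurable[OF Y fm])
  \<comment> \<open>The modular integrand at scale \<open>\<epsilon>\<close> becomes the density of
    a finite measure, so continuity from above can be applied to it.\<close>
  define \<nu> where "\<nu> = density \<mu> p"
  have \<nu>: "emeasure \<nu> A = (\<integral>\<^sup>+x. p x * indicator A x \<partial>\<mu>)" if "A \<in> sets \<mu>" for A
    unfolding \<nu>_def using pm that by (rule emeasure_density)
  have \<nu>s: "sets \<nu> = sets \<mu>" by (simp add: \<nu>_def)
  have U: "UNIV \<in> sets \<mu>" using s by simp
  have fin: "emeasure \<nu> UNIV < \<infinity>"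
    using orlicz_modular_finite[OF Y f M \<epsilon>] \<nu>[OF U] by (simp add: orlicz_modular_def p_def)
  obtain C :: "nat \<Rightarrow> 'g set" where C: "\<And>i. compact (C i)" "incseq C" "(\<Union>i. C i) = UNIV"
    using compact_exhaustion[OF lc] by blast
  \<comment> \<open>On \<open>B i\<close> the density is at most \<open>i\<close> and the points
    stay in a compact set; the complements decrease to the empty set, so one of them has small
    \<open>\<nu>\<close>-measure.\<close>
  define B where "B i = {x \<in> space \<mu>. p x \<le> of_nat i} \<inter> C i" for i
  have Cs: "C i \<in> sets \<mu>" for i
    unfolding s using compact_imp_closed[OF C(1)] by (rule borel_closed)
  have Bs: "B i \<in> sets \<mu>" for i
    unfolding B_def using pm Cs by (intro sets.Int) auto
  have Bmono: "B i \<subseteq> B j" if "i \<le> j" for i j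
  proof -
    have "(of_nat i :: ennreal) \<le> of_nat j" using that by simp
    then show ?thesis
      unfolding B_def using incseqD[OF C(2) that] by (auto intro: order_trans)
  qed
  then have "decseq (\<lambda>i. UNIV - B i)"
    unfolding decseq_def by blast
  moreover have BUs: "UNIV - B i \<in> sets \<nu>" for i
    using U Bs \<nu>s by auto
  moreover have Bfin: "emeasure \<nu> (UNIV - B i) \<noteq> \<infinity>" for i
    using emeasure_mono[of "UNIV - B i" UNIV \<nu>] fin U \<nu>s by (auto simp: top_unique)
  ultimately have lim: "(\<lambda>i. emeasure \<nu> (UNIV - B i)) \<longlonglongrightarrow> emeasure \<nu> (\<Inter>i. UNIV - B i)"
    using BUs \<nu>s Bfin by (intro Lim_emeasure_decseq) auto
  have "\<exists>i. x \<in> B i" for x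
  proof -
    obtain i where i: "x \<in> C i" using C(3) by blast
    obtain j :: nat where "\<Phi> (norm (f x) / \<epsilon>) \<le> j" using real_arch_simple by blast
    then have "p x \<le> ennreal (real j)" unfolding p_def by (rule ennreal_leI)
    then have j: "p x \<le> of_nat j" by (simp add: ennreal_of_nat_eq_real_of_nat)
    have "(of_nat j :: ennreal) \<le> of_nat (max i j)" by simp
    then have "p x \<le> of_nat (max i j)" using j by (rule order_trans[rotated])
    moreover have "x \<in> C (max i j)" using i incseqD[OF C(2), of i "max i j"] by auto
    ultimately have "x \<in> B (max i j)" unfolding B_def by (simp add: sp)
    then show ?thesis by blast
  qed
  then have "(\<Inter>i. UNIV - B i) = {}" by blast
  with lim have "(\<lambda>i. emeasure \<nu> (UNIV - B i)) \<longlonglongrightarrow> 0" by (simp only: emeasure_empty)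
  moreover have "(0 :: ennreal) < ennreal (1/2)" by (simp only: ennreal_less_zero_iff)
  ultimately have "\<forall>\<^sub>F i in sequentially. emeasure \<nu> (UNIV - B i) < ennreal (1/2)"
    by (rule order_tendstoD(2))
  then obtain i where i: "emeasure \<nu> (UNIV - B i) < ennreal (1/2)"
    using eventually_happens'[OF sequentially_bot] by blast
  \<comment> \<open>A set of measure \<open>\<delta>\<close> on which the density is at most
    \<open>i\<close> contributes at most \<open>1/2\<close>; adding \<open>1\<close> covers
    \<open>i = 0\<close>.\<close>
  define \<delta> where "\<delta> = 1 / (2 * (real i + 1))"
  have "\<delta> > 0" by (simp add: \<delta>_def)
  moreover have "real i * \<delta> \<le> 1 / 2" by (simp add: \<delta>_def divide_simps)
  ultimately have \<delta>: "\<delta> > 0" "real i * \<delta> \<le> 1 / 2" .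
  show ?thesis
  proof (rule that[of "C i" \<delta>])
    fix E assume E: "E \<in> sets \<mu>" "emeasure \<mu> (C i - E) \<le> ennreal \<delta>"
    have CE: "C i - E \<in> sets \<mu>" "UNIV - B i \<in> sets \<mu>" "C i \<inter> (B i - E) \<in> sets \<mu>"
      using E(1) Cs Bs U by (auto intro!: sets.Diff sets.Int)
    \<comment> \<open>The integrand vanishes on \<open>E\<close>. Off \<open>E\<close>, points
      outside \<open>B i\<close> are charged to \<open>\<nu>\<close>, and points of
      \<open>B i\<close> lie in \<open>C i - E\<close> and contribute density at most
      \<open>i\<close>.\<close>
    have "orlicz_modular \<Phi> \<mu> (\<lambda>x. f x - indicator E x * f x) \<epsilon> \<le>
        (\<integral>\<^sup>+x. p x * indicator (UNIV - B i) x + of_nat i * indicator (C i - E) x \<partial>\<mu>)"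
      unfolding orlicz_modular_def using young_functionD(4)[OF Y] sp
      by (intro nn_integral_mono) (auto simp: indicator_def p_def B_def)
    also have "\<dots> = emeasure \<nu> (UNIV - B i) + of_nat i * emeasure \<mu> (C i - E)"
      using pm CE by (subst nn_integral_add) (auto simp: \<nu> nn_integral_cmult_indicator)
    also have "\<dots> \<le> ennreal (1/2) + of_nat i * ennreal \<delta>"
      using i E(2) by (intro add_mono mult_left_mono) auto
    also have "\<dots> = ennreal (1/2 + real i * \<delta>)"
      using \<delta> by (simp add: ennreal_of_nat_eq_real_of_nat ennreal_mult ennreal_plus del: ennreal_half)
    also have "\<dots> \<le> 1"
    proof -
      have "1/2 + real i * \<delta> \<le> 1" using \<delta> by simp
      then show ?thesis by (simp only: ennreal_le_1)
    qed
    finally show "luxemburg_norm \<Phi> \<mu> (\<lambda>x. f x - indicator E x * f x) \<le> \<epsilon>"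
      by (rule luxemburg_norm_le[OF \<epsilon>])
  qed (use C \<delta> in auto)
qed

lemma right_haar_measure_translate:
  fixes \<mu> :: "'g::{topological_group_add, t2_space} measure"
  assumes \<mu>: "right_haar_measure \<mu>" and A: "A \<in> sets \<mu>"
  shows "{x. x - a \<in> A} \<in> sets \<mu>" "emeasure \<mu> {x. x - a \<in> A} = emeasure \<mu> A"
proof -
  have "sets \<mu> = sets borel" using \<mu> by (auto simp: right_haar_measure_def)
  then have sp: "space \<mu> = UNIV" using sets_eq_imp_space_eq by fastforce
  have eq: "{x. x - a \<in> A} = (\<lambda>x. x - a) -` A \<inter> space \<mu>" by (auto simp: sp)
  show "{x. x - a \<in> A} \<in> sets \<mu>"
    unfolding eq using right_haar_measure_distr(2)[OF \<mu>] A by (rule measurable_sets)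
  show "emeasure \<mu> {x. x - a \<in> A} = emeasure \<mu> A"
    unfolding eq emeasure_distr[OF right_haar_measure_distr(2)[OF \<mu>, of a] A, symmetric]
    by (simp add: right_haar_measure_distr(1)[OF \<mu>])
qed

text \<open>Right invariance gives a translate the same modular, so an admissible scale
  \<open>k\<close> for \<open>f\<close> becomes the admissible scale \<open>c * k\<close> for
  \<open>u\<close>. Iterates of the operator and of its inverse are estimated this way.\<close>

lemma orlicz_translate_dominated:
  fixes \<mu> :: "'g::{topological_group_add, t2_space} measure"
  assumes \<mu>: "right_haar_measure \<mu>" and Y: "young_function \<Phi>"
    and f: "f \<in> borel_measurable \<mu>" "k > 0" "orlicz_modular \<Phi> \<mu> f k \<le> 1"
    and u: "u \<in> borel_measurable \<mu>" and c: "c > 0" "\<And>x. norm (u x) \<le> c * norm (f (x - a))"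
  shows "u \<in> orlicz_functions \<Phi> \<mu>" "luxemburg_norm \<Phi> \<mu> u \<le> c * k"
proof -
  have "\<Phi> (norm (u x) / (c * k)) \<le> \<Phi> (norm (f (x - a)) / k)" for x
    using c f(2) by (intro young_mono[OF Y]) (auto simp: field_simps)
  then have "orlicz_modular \<Phi> \<mu> u (c * k) \<le> (\<integral>\<^sup>+x. ennreal (\<Phi> (norm (f (x - a)) / k)) \<partial>\<mu>)"
    unfolding orlicz_modular_def by (intro nn_integral_mono ennreal_leI)
  also have "\<dots> = (\<integral>\<^sup>+x. ennreal (\<Phi> (norm (f x) / k)) \<partial>(distr \<mu> \<mu> (\<lambda>x. x - a)))"
    using orlicz_modular_measurable[OF Y f(1), of k] right_haar_measure_distr(2)[OF \<mu>, of a]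
    by (subst nn_integral_distr) auto
  also have "\<dots> = orlicz_modular \<Phi> \<mu> f k"
    by (simp add: right_haar_measure_distr(1)[OF \<mu>] orlicz_modular_def)
  also have "\<dots> \<le> 1" by (rule f(3))
  finally have le: "orlicz_modular \<Phi> \<mu> u (c * k) \<le> 1" .
  have ck: "c * k > 0" using c f by simp
  show "u \<in> orlicz_functions \<Phi> \<mu>" using orlicz_functions_iff[OF Y] u le ck by metis
  show "luxemburg_norm \<Phi> \<mu> u \<le> c * k" using luxemburg_norm_le[OF ck le] .
qed

text \<open>Norm convergence implies convergence in measure: since \<open>\<Phi>\<close> is
  unbounded, Markov's inequality applies to the modular at a small scale.\<close>

lemma luxemburg_norm_small_measure:
  fixes \<mu> :: "'a measure" and \<epsilon> \<eta> :: real
  assumes Y: "young_function \<Phi>" and \<epsilon>: "\<epsilon> > 0" and \<eta>: "\<eta> > 0"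
  obtains \<delta> where "\<delta> > 0"
    "\<And>f. f \<in> orlicz_functions \<Phi> \<mu> \<Longrightarrow> luxemburg_norm \<Phi> \<mu> f < \<delta> \<Longrightarrow>
       emeasure \<mu> {x \<in> space \<mu>. norm (f x) \<ge> \<epsilon>} \<le> ennreal \<eta>"
proof -
  have "filterlim \<Phi> at_top at_top" using Y by (simp add: young_function_def)
  then obtain t0 where t0: "\<And>t. t \<ge> t0 \<Longrightarrow> \<Phi> t \<ge> 1 / \<eta>"
    unfolding filterlim_at_top eventually_at_top_linorder by blast
  \<comment> \<open>For a scale \<open>k < \<delta>\<close>, a value of size at least
    \<open>\<epsilon>\<close> becomes at least \<open>t0\<close> after division by \<open>k\<close>,
    where \<open>\<Phi>\<close> is at least \<open>1 / \<eta>\<close>. The maximum guards against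
    \<open>t0 \<le> 0\<close>.\<close>
  define \<delta> where "\<delta> = \<epsilon> / max t0 1"
  have \<delta>: "\<delta> > 0" using \<epsilon> by (simp add: \<delta>_def)
  show ?thesis
  proof (rule that[OF \<delta>])
    fix f :: "'a \<Rightarrow> complex"
    assume f: "f \<in> orlicz_functions \<Phi> \<mu>" and less: "luxemburg_norm \<Phi> \<mu> f < \<delta>"
    have fm: "f \<in> borel_measurable \<mu>" using f by (simp add: orlicz_functions_def)
    obtain k where k: "0 < k" "k < \<delta>" "orlicz_modular \<Phi> \<mu> f k \<le> 1"
      using luxemburg_norm_less[OF Y f less] .
    have pm: "(\<lambda>x. ennreal (\<Phi> (norm (f x) / k))) \<in> borel_measurable \<mu>"
      by (rule orlicz_modular_measurable[OF Y fm])
    have "{x \<in> space \<mu>. norm (f x) \<ge> \<epsilon>} \<subseteq>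
        {x \<in> space \<mu>. 1 \<le> ennreal \<eta> * ennreal (\<Phi> (norm (f x) / k))}"
    proof (intro Collect_mono impI conjI; elim conjE)
      fix x assume x: "norm (f x) \<ge> \<epsilon>"
      have "k * max t0 1 \<le> \<epsilon>" using k(2) by (auto simp: \<delta>_def field_simps)
      then have "max t0 1 * k \<le> norm (f x)" using x by (simp add: mult.commute)
      then have "max t0 1 \<le> norm (f x) / k" using k(1) by (simp only: pos_le_divide_eq)
      then have "1 \<le> \<eta> * \<Phi> (norm (f x) / k)" using t0[of "norm (f x) / k"] \<eta> by (simp add: field_simps)
      then show "1 \<le> ennreal \<eta> * ennreal (\<Phi> (norm (f x) / k))"
        using \<eta> by (simp add: ennreal_mult'[symmetric] ennreal_leI flip: ennreal_1)
    qed
    then have "emeasure \<mu> {x \<in> space \<mu>. norm (f x) \<ge> \<epsilon>} \<le>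
        emeasure \<mu> {x \<in> space \<mu>. 1 \<le> ennreal \<eta> * ennreal (\<Phi> (norm (f x) / k))}"
      using pm by (intro emeasure_mono borel_measurable_le borel_measurable_const borel_measurable_times_ennreal) auto
    also have "\<dots> \<le> ennreal \<eta> * (\<integral>\<^sup>+x. ennreal (\<Phi> (norm (f x) / k)) * indicator (space \<mu>) x \<partial>\<mu>)"
      using pm by (intro nn_integral_Markov_inequality) auto
    also have "\<dots> = ennreal \<eta> * orlicz_modular \<Phi> \<mu> f k"
      unfolding orlicz_modular_def by (intro arg_cong2[where f="(*)"] refl nn_integral_cong) auto
    also have "\<dots> \<le> ennreal \<eta> * 1" using k(3) by (intro mult_left_mono) auto
    finally show "emeasure \<mu> {x \<in> space \<mu>. norm (f x) \<ge> \<epsilon>} \<le> ennreal \<eta>" by simp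
  qed
qed

lemma orlicz_functions_sum:
  assumes Y: "young_function \<Phi>" and "finite I" and "\<And>i. i \<in> I \<Longrightarrow> u i \<in> orlicz_functions \<Phi> \<mu>"
  shows "(\<lambda>x. \<Sum>i\<in>I. u i x) \<in> orlicz_functions \<Phi> \<mu>"
    and "luxemburg_norm \<Phi> \<mu> (\<lambda>x. \<Sum>i\<in>I. u i x) \<le> (\<Sum>i\<in>I. luxemburg_norm \<Phi> \<mu> (u i))"
proof -
  have zero: "(\<lambda>_. 0) \<in> orlicz_functions \<Phi> \<mu>"
    using young_functionD(4)[OF Y] by (auto simp: orlicz_functions_def intro: exI[of _ 1])
  have "(\<lambda>x. \<Sum>i\<in>I. u i x) \<in> orlicz_functions \<Phi> \<mu> \<and>
    luxemburg_norm \<Phi> \<mu> (\<lambda>x. \<Sum>i\<in>I. u i x) \<le> (\<Sum>i\<in>I. luxemburg_norm \<Phi> \<mu> (u i))"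
    using assms(2,3)
  proof (induction I rule: finite_induct)
    case empty
    then show ?case using zero luxemburg_norm_eq_0_iff[OF Y zero] by simp
  next
    case (insert i I)
    then have IH: "(\<lambda>x. \<Sum>i\<in>I. u i x) \<in> orlicz_functions \<Phi> \<mu>"
      "luxemburg_norm \<Phi> \<mu> (\<lambda>x. \<Sum>i\<in>I. u i x) \<le> (\<Sum>i\<in>I. luxemburg_norm \<Phi> \<mu> (u i))"
      by auto
    have i: "u i \<in> orlicz_functions \<Phi> \<mu>" using insert by auto
    show ?case
      using orlicz_functions_add[OF Y i IH(1)] luxemburg_norm_triangle[OF Y i IH(1)] IH(2) insert(1,2)
      by simp
  qed
  then show "(\<lambda>x. \<Sum>i\<in>I. u i x) \<in> orlicz_functions \<Phi> \<mu>"
    "luxemburg_norm \<Phi> \<mu> (\<lambda>x. \<Sum>i\<in>I. u i x) \<le> (\<Sum>i\<in>I. luxemburg_norm \<Phi> \<mu> (u i))"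
    by auto
qed

section \<open>Weighted translations\<close>

text \<open>The product \<open>w x * w (x - a) * ... * w (x - (n - 1) a)\<close>, the multiplier of
  the \<open>n\<close>-th power of the weighted shift.\<close>

primrec weight_cocycle :: "'g::group_add \<Rightarrow> ('g \<Rightarrow> real) \<Rightarrow> nat \<Rightarrow> 'g \<Rightarrow> real" where
  "weight_cocycle a w 0 x = 1"
| "weight_cocycle a w (Suc n) x = w x * weight_cocycle a w n (x - a)"

text \<open>For positive \<open>w\<close> this is the inverse of \<open>weighted_shift a w\<close>
  on functions.\<close>

definition weighted_unshift ::
    "'g::group_add \<Rightarrow> ('g \<Rightarrow> real) \<Rightarrow> ('g \<Rightarrow> complex) \<Rightarrow> ('g \<Rightarrow> complex)" where
  "weighted_unshift a w f = (\<lambda>x. f (x + a) / of_real (w (x + a)))"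

lemma weight_cocycle_pos: "(\<And>x. w x > 0) \<Longrightarrow> weight_cocycle a w n x > 0"
  by (induction n arbitrary: x) auto

lemma funpow_weighted_shift:
  "(weighted_shift a w ^^ n) f x = of_real (weight_cocycle a w n x) * f (x - nmult n a)"
proof (induction n arbitrary: x)
  case (Suc n)
  have "x - a - nmult n a = x - nmult (Suc n) a"
    by (simp only: nmult_Suc' diff_add_eq_diff_diff_swap)
  then show ?case using Suc[of "x - a"] by (simp add: weighted_shift_def)
qed simp

lemma funpow_weighted_unshift:
  "(weighted_unshift a w ^^ n) f x =
    f (x + nmult n a) / of_real (weight_cocycle a w n (x + nmult n a))"
proof (induction n arbitrary: f)
  case (Suc n)
  have "(weighted_unshift a w ^^ Suc n) f x = (weighted_unshift a w ^^ n) (weighted_unshift a w f) x"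
    by (simp add: funpow_swap1)
  also have "\<dots> = weighted_unshift a w f (x + nmult n a) / of_real (weight_cocycle a w n (x + nmult n a))"
    by (rule Suc)
  also have "\<dots> = f (x + nmult (Suc n) a) / of_real (weight_cocycle a w (Suc n) (x + nmult (Suc n) a))"
    by (simp add: weighted_unshift_def nmult_Suc' mult.commute add_diff_eq del: nmult.simps flip: add.assoc)
  finally show ?case .
qed simp

lemma weighted_shift_unshift:
  assumes "\<And>x. w x > 0"
  shows "weighted_shift a w (weighted_unshift a w f) = f"
proof
  fix x
  have "w x \<noteq> 0" using assms[of x] by simp
  then show "weighted_shift a w (weighted_unshift a w f) x = f x"
    by (simp add: weighted_shift_def weighted_unshift_def)
qed

text \<open>Adjacent shift and unshift cancel in pairs, leaving a pure power of whichever occurs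
  more often.\<close>

lemma funpow_weighted_shift_unshift:
  assumes w: "\<And>x. w x > 0"
  shows "(weighted_shift a w ^^ m) ((weighted_unshift a w ^^ n) f) =
    (if n \<le> m then (weighted_shift a w ^^ (m - n)) f else (weighted_unshift a w ^^ (n - m)) f)"
proof (induction m arbitrary: n)
  case (Suc m)
  show ?case
  proof (cases n)
    case (Suc n')
    have "(weighted_shift a w ^^ Suc m) ((weighted_unshift a w ^^ n) f) =
        (weighted_shift a w ^^ m) (weighted_shift a w (weighted_unshift a w ((weighted_unshift a w ^^ n') f)))"
      unfolding Suc funpow_Suc_right[of m] funpow.simps(2)[of n'] by simp
    also have "\<dots> = (weighted_shift a w ^^ m) ((weighted_unshift a w ^^ n') f)"
      by (simp only: weighted_shift_unshift[OF w])
    finally have "(weighted_shift a w ^^ Suc m) ((weighted_unshift a w ^^ n) f) =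
        (weighted_shift a w ^^ m) ((weighted_unshift a w ^^ n') f)" .
    then show ?thesis using Suc.IH[of n'] Suc by simp
  qed simp
qed simp

lemma measurable_weighted_unshift:
  fixes \<mu> :: "'g::{topological_group_add, t2_space} measure"
  assumes \<mu>: "right_haar_measure \<mu>" and w: "weight w" and f: "f \<in> borel_measurable \<mu>"
  shows "(weighted_unshift a w ^^ n) f \<in> borel_measurable \<mu>"
proof (induction n)
  case (Suc n)
  have s: "sets \<mu> = sets borel" using \<mu> by (simp add: right_haar_measure_def)
  have tr: "(\<lambda>x. x + a) \<in> measurable \<mu> \<mu>"
    using right_haar_measure_distr(2)[OF \<mu>, of "- a"] by simp
  from w have "w \<in> borel_measurable borel"
    unfolding weight_def by (intro borel_measurable_continuous_onI) auto
  then have "w \<in> borel_measurable \<mu>" using measurable_cong_sets[OF s refl] by blast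
  then have wm: "(\<lambda>x. w (x + a)) \<in> borel_measurable \<mu>"
    by (rule measurable_compose[OF tr])
  have "(\<lambda>x. (weighted_unshift a w ^^ n) f (x + a)) \<in> borel_measurable \<mu>"
    using tr Suc by (rule measurable_compose)
  then have "(\<lambda>x. (weighted_unshift a w ^^ n) f (x + a) / of_real (w (x + a))) \<in> borel_measurable \<mu>"
    using wm by measurable
  then show ?case by (simp add: weighted_unshift_def[of a w "(weighted_unshift a w ^^ n) f"])
qed (use f in simp)

lemma funpow_weighted_shift_orlicz:
  fixes \<mu> :: "'g::{topological_group_add, t2_space} measure"
  assumes "right_haar_measure \<mu>" "weight w" "young_function \<Phi>" "f \<in> orlicz_functions \<Phi> \<mu>"
  shows "(weighted_shift a w ^^ n) f \<in> orlicz_functions \<Phi> \<mu>"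
  by (induction n) (use assms in \<open>auto intro: weighted_shift_orlicz\<close>)

section \<open>Passage between functions and their classes\<close>

definition orlicz_class ::
    "(real \<Rightarrow> real) \<Rightarrow> 'g measure \<Rightarrow> ('g \<Rightarrow> complex) \<Rightarrow> ('g \<Rightarrow> complex) set" where
  "orlicz_class \<Phi> \<mu> f = orlicz_rel \<Phi> \<mu> `` {f}"

lemma orlicz_class_self: "f \<in> orlicz_functions \<Phi> \<mu> \<Longrightarrow> f \<in> orlicz_class \<Phi> \<mu> f"
  unfolding orlicz_class_def by (rule equiv_class_self[OF equiv_orlicz_rel])

lemma orlicz_class_in_space: "f \<in> orlicz_functions \<Phi> \<mu> \<Longrightarrow> orlicz_class \<Phi> \<mu> f \<in> orlicz_space \<Phi> \<mu>"
  unfolding orlicz_class_def orlicz_space_def by (rule quotientI)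

lemma orlicz_spaceE:
  assumes "F \<in> orlicz_space \<Phi> \<mu>"
  obtains f where "f \<in> orlicz_functions \<Phi> \<mu>" "F = orlicz_class \<Phi> \<mu> f"
  using assms unfolding orlicz_space_def orlicz_class_def by (auto elim: quotientE)

lemma orlicz_dist_class:
  assumes "f \<in> orlicz_functions \<Phi> \<mu>" "g \<in> orlicz_functions \<Phi> \<mu>"
  shows "orlicz_dist \<Phi> \<mu> (orlicz_class \<Phi> \<mu> f) (orlicz_class \<Phi> \<mu> g) =
    luxemburg_norm \<Phi> \<mu> (\<lambda>x. f x - g x)"
  using assms by (intro orlicz_dist_representatives orlicz_class_in_space orlicz_class_self)

lemma funpow_weighted_translation_class:
  fixes \<mu> :: "'g::{topological_group_add, t2_space} measure"
  assumes "right_haar_measure \<mu>" "weight w" "young_function \<Phi>" "f \<in> orlicz_functions \<Phi> \<mu>"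
  shows "(weighted_translation \<Phi> \<mu> a w ^^ n) (orlicz_class \<Phi> \<mu> f) =
    orlicz_class \<Phi> \<mu> ((weighted_shift a w ^^ n) f)"
proof (induction n)
  case (Suc n)
  then show ?case
    using weighted_translation_class[OF assms(1-3) funpow_weighted_shift_orlicz[OF assms]]
    by (simp add: orlicz_class_def)
qed simp

lemma openin_orlicz_topologyE:
  assumes Y: "young_function \<Phi>" and U: "openin (orlicz_topology \<Phi> \<mu>) U" "U \<noteq> {}"
  obtains f e where "f \<in> orlicz_functions \<Phi> \<mu>" "e > 0"
    "\<And>g. g \<in> orlicz_functions \<Phi> \<mu> \<Longrightarrow> luxemburg_norm \<Phi> \<mu> (\<lambda>x. f x - g x) < e \<Longrightarrow>
       orlicz_class \<Phi> \<mu> g \<in> U"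
proof -
  interpret Metric_space "orlicz_space \<Phi> \<mu>" "orlicz_dist \<Phi> \<mu>" by (rule Metric_space_orlicz[OF Y])
  obtain F where F: "F \<in> U" using U(2) by blast
  then obtain e where e: "e > 0" "mball F e \<subseteq> U" "F \<in> orlicz_space \<Phi> \<mu>"
    using U(1) unfolding orlicz_topology_def openin_mtopology by blast
  obtain f where f: "f \<in> orlicz_functions \<Phi> \<mu>" "F = orlicz_class \<Phi> \<mu> f"
    using orlicz_spaceE[OF e(3)] .
  show ?thesis
  proof (rule that[OF f(1) e(1)])
    fix g assume g: "g \<in> orlicz_functions \<Phi> \<mu>" "luxemburg_norm \<Phi> \<mu> (\<lambda>x. f x - g x) < e"
    then have "orlicz_class \<Phi> \<mu> g \<in> mball F e"
      using f e(3) orlicz_class_in_space[OF g(1)] orlicz_dist_class[OF f(1) g(1)] by simp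
    then show "orlicz_class \<Phi> \<mu> g \<in> U" using e(2) by blast
  qed
qed

section \<open>Consequences of mixing for the weight cocycle\<close>

text \<open>Mixing is applied with both open sets equal to one ball around the class of
  \<open>f\<close>, and the result is read off on representatives.\<close>

lemma mixing_approx_return:
  fixes \<mu> :: "'g::{topological_group_add, t2_space} measure"
  assumes \<mu>: "right_haar_measure \<mu>" and w: "weight w" and Y: "young_function \<Phi>"
    and mix: "topologically_mixing (orlicz_topology \<Phi> \<mu>) (weighted_translation \<Phi> \<mu> a w)"
    and f: "f \<in> orlicz_functions \<Phi> \<mu>" and e: "e > 0"
  obtains N where "\<And>n. n \<ge> N \<Longrightarrow> \<exists>g \<in> orlicz_functions \<Phi> \<mu>.
      luxemburg_norm \<Phi> \<mu> (\<lambda>x. f x - g x) < e \<and>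
      luxemburg_norm \<Phi> \<mu> (\<lambda>x. f x - (weighted_shift a w ^^ n) g x) < e"
proof -
  interpret Metric_space "orlicz_space \<Phi> \<mu>" "orlicz_dist \<Phi> \<mu>" by (rule Metric_space_orlicz[OF Y])
  define B where "B = mball (orlicz_class \<Phi> \<mu> f) e"
  have B: "openin (orlicz_topology \<Phi> \<mu>) B" "B \<noteq> {}"
    using e orlicz_class_in_space[OF f] unfolding B_def orlicz_topology_def by auto
  then obtain N where N: "\<And>n. n \<ge> N \<Longrightarrow> (weighted_translation \<Phi> \<mu> a w ^^ n) ` B \<inter> B \<noteq> {}"
    using mix unfolding topologically_mixing_def by metis
  show ?thesis
  proof (rule that[of N])
    fix n assume "n \<ge> N"
    from N[OF this] obtain F where F: "F \<in> B" "(weighted_translation \<Phi> \<mu> a w ^^ n) F \<in> B" by blast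
    then obtain g where g: "g \<in> orlicz_functions \<Phi> \<mu>" "F = orlicz_class \<Phi> \<mu> g"
      using orlicz_spaceE unfolding B_def by (metis in_mball)
    have g': "(weighted_shift a w ^^ n) g \<in> orlicz_functions \<Phi> \<mu>"
      by (rule funpow_weighted_shift_orlicz[OF \<mu> w Y g(1)])
    have "orlicz_class \<Phi> \<mu> ((weighted_shift a w ^^ n) g) \<in> B"
      using F(2) g funpow_weighted_translation_class[OF \<mu> w Y g(1)] by simp
    then show "\<exists>g \<in> orlicz_functions \<Phi> \<mu>. luxemburg_norm \<Phi> \<mu> (\<lambda>x. f x - g x) < e \<and>
      luxemburg_norm \<Phi> \<mu> (\<lambda>x. f x - (weighted_shift a w ^^ n) g x) < e"
      using F(1) g orlicz_dist_class[OF f g(1)] orlicz_dist_class[OF f g']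
      unfolding B_def by auto
  qed
qed

text \<open>Mixing near \<open>1\<^sub>K\<close> gives \<open>g\<close> with both \<open>g\<close> and \<open>T\<^sup>n g\<close> close to \<open>1\<^sub>K\<close>.  For large \<open>n\<close> the
  translates of \<open>K\<close> by \<open>\<plusminus>n a\<close> miss \<open>K\<close>, so off a small set \<open>T\<^sup>n g\<close> is of size \<open>1\<close> at \<open>x\<close> while
  \<open>g\<close> is small at \<open>x - n a\<close>, and \<open>g\<close> is of size \<open>1\<close> at \<open>x\<close> while \<open>T\<^sup>n g\<close> is small at \<open>x + n a\<close>.\<close>

lemma mixing_imp_weight_cocycle_bounds:
  fixes \<mu> :: "'g::{topological_group_add, t2_space, first_countable_topology} measure"
  assumes lc: "locally_compact_space (euclidean :: 'g topology)" and ap: "aperiodic a"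
    and \<mu>: "right_haar_measure \<mu>" and w: "weight w" and Y: "young_function \<Phi>"
    and mix: "topologically_mixing (orlicz_topology \<Phi> \<mu>) (weighted_translation \<Phi> \<mu> a w)"
    and K: "compact K" and \<epsilon>: "\<epsilon> > 0" and \<eta>: "\<eta> > 0"
  obtains N where "\<And>n. n \<ge> N \<Longrightarrow> \<exists>E\<in>sets \<mu>. emeasure \<mu> (K - E) \<le> ennreal \<eta> \<and>
      (\<forall>x\<in>E. 1 / \<epsilon> < weight_cocycle a w n x \<and> weight_cocycle a w n (x + nmult n a) < \<epsilon>)"
proof -
  have s: "sets \<mu> = sets borel" using \<mu> by (auto simp: right_haar_measure_def)
  then have sp: "space \<mu> = UNIV" using sets_eq_imp_space_eq by fastforce
  have Ks: "K \<in> sets \<mu>" unfolding s using compact_imp_closed[OF K] by (rule borel_closed)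
  have wpos: "\<And>x. w x > 0" using w by (simp add: weight_def)
  \<comment> \<open>The bound \<open>1 / 2\<close> keeps functions within \<open>e\<close> of
    \<open>1\<close> larger than \<open>1 / 2\<close> in modulus; the bound
    \<open>\<epsilon> / 2\<close> absorbs the factor \<open>2\<close> this costs in both cocycle
    estimates.\<close>
  define e where "e = min (\<epsilon> / 2) (1 / 2)"
  have e: "e > 0" "2 * e \<le> \<epsilon>" "e \<le> 1 / 2" using \<epsilon> by (auto simp: e_def)
  \<comment> \<open>Four exceptional sets are removed from \<open>K\<close>: \<open>A\<close>,
    \<open>B\<close> and one translate of each.\<close>
  have "\<eta> / 4 > 0" using \<eta> by simp
  from luxemburg_norm_small_measure[OF Y e(1) this, of \<mu>] obtain \<delta> where \<delta>: "\<delta> > 0"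
    "\<And>f. f \<in> orlicz_functions \<Phi> \<mu> \<Longrightarrow> luxemburg_norm \<Phi> \<mu> f < \<delta> \<Longrightarrow>
       emeasure \<mu> {x \<in> space \<mu>. norm (f x) \<ge> e} \<le> ennreal (\<eta> / 4)" by metis
  define \<xi> :: "'g \<Rightarrow> complex" where "\<xi> = indicator K"
  have \<xi>: "\<xi> \<in> orlicz_functions \<Phi> \<mu>"
    unfolding \<xi>_def by (rule orlicz_functions_indicator_compact[OF Y \<mu> K])
  obtain N1 where N1: "\<And>n. n \<ge> N1 \<Longrightarrow> \<exists>g \<in> orlicz_functions \<Phi> \<mu>.
      luxemburg_norm \<Phi> \<mu> (\<lambda>x. \<xi> x - g x) < \<delta> \<and>
      luxemburg_norm \<Phi> \<mu> (\<lambda>x. \<xi> x - (weighted_shift a w ^^ n) g x) < \<delta>"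
    using mixing_approx_return[OF \<mu> w Y mix \<xi> \<delta>(1)] by blast
  obtain N2 where N2: "\<And>n x. n \<ge> N2 \<Longrightarrow> x \<in> K \<Longrightarrow> x + nmult n a \<notin> K \<and> x - nmult n a \<notin> K"
    using aperiodic_eventually_disjoint[OF lc ap K] by blast
  show ?thesis
  proof (rule that[of "max N1 N2"])
    fix n assume n: "n \<ge> max N1 N2"
    define W where "W = weight_cocycle a w n"
    have Wpos: "W x > 0" for x unfolding W_def using wpos by (rule weight_cocycle_pos)
    obtain g where g: "g \<in> orlicz_functions \<Phi> \<mu>"
      "luxemburg_norm \<Phi> \<mu> (\<lambda>x. \<xi> x - g x) < \<delta>"
      "luxemburg_norm \<Phi> \<mu> (\<lambda>x. \<xi> x - (weighted_shift a w ^^ n) g x) < \<delta>"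
      using N1[of n] n by auto
    define h where "h = (weighted_shift a w ^^ n) g"
    have h: "h \<in> orlicz_functions \<Phi> \<mu>" unfolding h_def by (rule funpow_weighted_shift_orlicz[OF \<mu> w Y g(1)])
    have h_eq: "norm (h x) = W x * norm (g (x - nmult n a))" for x
      unfolding h_def funpow_weighted_shift using Wpos[of x] by (simp add: norm_mult W_def)
    define A where "A = {x \<in> space \<mu>. norm (\<xi> x - g x) \<ge> e}"
    define B where "B = {x \<in> space \<mu>. norm (\<xi> x - h x) \<ge> e}"
    define A' where "A' = {x. x - nmult n a \<in> A}"
    define B' where "B' = {x. x - (- nmult n a) \<in> B}"
    have d: "(\<lambda>x. \<xi> x - g x) \<in> orlicz_functions \<Phi> \<mu>" "(\<lambda>x. \<xi> x - h x) \<in> orlicz_functions \<Phi> \<mu>"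
      using orlicz_functions_diff[OF Y \<xi>] g(1) h by auto
    then have "(\<lambda>x. \<xi> x - g x) \<in> borel_measurable \<mu>" "(\<lambda>x. \<xi> x - h x) \<in> borel_measurable \<mu>"
      by (auto simp: orlicz_functions_def)
    then have AB: "A \<in> sets \<mu>" "B \<in> sets \<mu>" unfolding A_def B_def by measurable
    have AB': "A' \<in> sets \<mu>" "B' \<in> sets \<mu>"
      unfolding A'_def B'_def using right_haar_measure_translate(1)[OF \<mu>] AB by blast+
    have small: "emeasure \<mu> A \<le> ennreal (\<eta> / 4)" "emeasure \<mu> B \<le> ennreal (\<eta> / 4)"
      unfolding A_def B_def using \<delta>(2) d g(2,3) unfolding h_def by auto
    have small': "emeasure \<mu> A' \<le> ennreal (\<eta> / 4)" "emeasure \<mu> B' \<le> ennreal (\<eta> / 4)"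
      unfolding A'_def B'_def right_haar_measure_translate(2)[OF \<mu> AB(1)]
        right_haar_measure_translate(2)[OF \<mu> AB(2)] by (rule small)+
    define E where "E = K - (A \<union> A' \<union> (B \<union> B'))"
    have "emeasure \<mu> (K - E) \<le> emeasure \<mu> (A \<union> A' \<union> (B \<union> B'))"
      using AB AB' by (intro emeasure_mono) (auto simp: E_def)
    also have "\<dots> \<le> (emeasure \<mu> A + emeasure \<mu> A') + (emeasure \<mu> B + emeasure \<mu> B')"
      using AB AB' by (intro order_trans[OF emeasure_subadditive] add_mono emeasure_subadditive sets.Un)
    also have "\<dots> \<le> (ennreal (\<eta> / 4) + ennreal (\<eta> / 4)) + (ennreal (\<eta> / 4) + ennreal (\<eta> / 4))"
      by (intro add_mono small small')
    also have "\<dots> = ennreal \<eta>" using \<eta> by (simp flip: ennreal_plus)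
    finally have measE: "emeasure \<mu> (K - E) \<le> ennreal \<eta>" .
    have bounds: "1 / \<epsilon> < W x \<and> W (x + nmult n a) < \<epsilon>" if x: "x \<in> E" for x
    proof -
      have xK: "x \<in> K" "x + nmult n a \<notin> K" "x - nmult n a \<notin> K"
        using x N2[of n x] n by (auto simp: E_def)
      \<comment> \<open>Since \<open>x\<close> avoids \<open>A'\<close> and \<open>B'\<close> and
        both translates of \<open>x\<close> lie outside \<open>K\<close>, where \<open>\<xi>\<close>
        is \<open>0\<close>, the values of \<open>g\<close> and \<open>h\<close> at the translates
        are small themselves.\<close>
      have near: "norm (1 - g x) < e" "norm (1 - h x) < e"
        "norm (g (x - nmult n a)) < e" "norm (h (x + nmult n a)) < e"
        using x xK sp by (auto simp: E_def A_def B_def A'_def B'_def \<xi>_def not_le)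
      have "norm (1 :: complex) \<le> norm (1 - g x) + norm (g x)" "norm (1 :: complex) \<le> norm (1 - h x) + norm (h x)"
        using norm_triangle_ineq[of "1 - g x" "g x"] norm_triangle_ineq[of "1 - h x" "h x"] by auto
      then have big: "norm (g x) > 1 / 2" "norm (h x) > 1 / 2" using near e(3) by auto
      have "1 / 2 < W x * norm (g (x - nmult n a))" using big(2) h_eq[of x] by simp
      also have "\<dots> \<le> W x * (\<epsilon> / 2)" using near(3) e(2) Wpos[of x] by (intro mult_left_mono) auto
      finally have "1 / \<epsilon> < W x" using \<epsilon> by (simp add: field_simps)
      moreover have "W (x + nmult n a) * (1 / 2) < W (x + nmult n a) * norm (g x)"
        using big(1) Wpos by (intro mult_strict_left_mono) auto
      then have "W (x + nmult n a) * (1 / 2) < e" using near(4) h_eq[of "x + nmult n a"] by simp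
      then have "W (x + nmult n a) < \<epsilon>" using e(2) by simp
      ultimately show ?thesis ..
    qed
    have "E \<in> sets \<mu>" unfolding E_def using Ks AB AB' by auto
    then show "\<exists>E\<in>sets \<mu>. emeasure \<mu> (K - E) \<le> ennreal \<eta> \<and>
      (\<forall>x\<in>E. 1 / \<epsilon> < weight_cocycle a w n x \<and> weight_cocycle a w n (x + nmult n a) < \<epsilon>)"
      using measE bounds unfolding W_def by blast
  qed
qed

section \<open>Multiple recurrence in the chaotic and the mixing case\<close>

lemma chaotic_imp_multiply_recurrent:
  assumes "chaotic X T"
  shows "topologically_multiply_recurrent X T"
  unfolding topologically_multiply_recurrent_def
proof (intro allI impI; elim conjE)
  fix L :: nat and U assume U: "openin X U" "U \<noteq> {}"
  then obtain y where y: "y \<in> U" "y \<in> X closure_of periodic_elements X T"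
    using assms openin_subset[OF U(1)] unfolding chaotic_def by blast
  then obtain x where x: "x \<in> U" "x \<in> periodic_elements X T"
    using U(1) unfolding in_closure_of by blast
  then obtain n where n: "n \<ge> 1" "(T ^^ n) x = x" unfolding periodic_elements_def by blast
  \<comment> \<open>All multiples of the period fix \<open>x\<close>, so a single point serves all
    \<open>L\<close> return conditions.\<close>
  have "(T ^^ (l * n)) x = x" for l
    by (induction l) (use n(2) in \<open>auto simp: funpow_add\<close>)
  then show "\<exists>n\<ge>1. U \<inter> (\<Inter>l\<in>{1..L}. (T ^^ (l * n)) -` U) \<noteq> {}"
    using x(1) n(1) by (intro exI[of _ n]) auto
qed

text \<open>If \<open>f\<^sub>1\<close> is the restriction of \<open>f \<in> U\<close> to the set where the cocycles along \<open>n, 2n, \<dots>, Ln\<close> are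
  controlled and \<open>S\<close> is the right inverse of \<open>T\<close>, then \<open>h = f\<^sub>1 + S\<^sup>n f\<^sub>1 + \<dots> + S\<^sup>L\<^sup>n f\<^sub>1\<close> is a multiply
  returning point: each \<open>T\<^sup>j\<^sup>n h\<close> consists of \<open>f\<^sub>1\<close> and of \<open>L\<close> small terms.\<close>

lemma mixing_imp_multiply_recurrent:
  fixes a :: "'g::{topological_group_add, t2_space, second_countable_topology}"
  assumes lc: "locally_compact_space (euclidean :: 'g topology)" and ap: "aperiodic a"
    and \<mu>: "right_haar_measure \<mu>" and w: "weight w" and Y: "young_function \<Phi>"
    and M: "M > 0" "\<And>t. t > 0 \<Longrightarrow> \<Phi> (2 * t) \<le> M * \<Phi> t"
    and mix: "topologically_mixing (orlicz_topology \<Phi> \<mu>) (weighted_translation \<Phi> \<mu> a w)"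
  shows "topologically_multiply_recurrent (orlicz_topology \<Phi> \<mu>) (weighted_translation \<Phi> \<mu> a w)"
  unfolding topologically_multiply_recurrent_def
proof (intro allI impI; elim conjE)
  fix L :: nat and U assume L: "1 \<le> L" and U: "openin (orlicz_topology \<Phi> \<mu>) U" "U \<noteq> {}"
  have wpos: "\<And>x. w x > 0" using w by (simp add: weight_def)
  define T where "T = weighted_shift a w"
  define S where "S = weighted_unshift a w"
  obtain f e where f: "f \<in> orlicz_functions \<Phi> \<mu>" and e: "e > 0" and
    ball: "\<And>g. g \<in> orlicz_functions \<Phi> \<mu> \<Longrightarrow> luxemburg_norm \<Phi> \<mu> (\<lambda>x. f x - g x) < e \<Longrightarrow>
       orlicz_class \<Phi> \<mu> g \<in> U"
    using openin_orlicz_topologyE[OF Y U] by metis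
  have fm: "f \<in> borel_measurable \<mu>" using f by (simp add: orlicz_functions_def)
  obtain k where k: "k > 0" "orlicz_modular \<Phi> \<mu> f k \<le> 1"
    using f orlicz_functions_iff[OF Y] by auto
  \<comment> \<open>One third of \<open>e\<close> pays for truncating \<open>f\<close>, another for
    all small terms together; the remaining third gives strict inequality.\<close>
  have "e / 3 > 0" using e by simp
  from orlicz_truncation[OF lc \<mu> Y M f this] obtain K \<delta> where K: "compact K" and \<delta>: "\<delta> > 0" and
    trunc: "\<And>E. E \<in> sets \<mu> \<Longrightarrow> emeasure \<mu> (K - E) \<le> ennreal \<delta> \<Longrightarrow>
       luxemburg_norm \<Phi> \<mu> (\<lambda>x. f x - indicator E x * f x) \<le> e / 3" by metis
  \<comment> \<open>Each \<open>T^j^n h\<close> will contain \<open>L\<close> unwanted terms of norm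
    at most \<open>\<epsilon> * k\<close>, which must add up to \<open>e / 3\<close>.\<close>
  define \<epsilon> where "\<epsilon> = e / (3 * real L * k)"
  have \<epsilon>: "\<epsilon> > 0" "real L * (\<epsilon> * k) = e / 3" using e k L by (auto simp: \<epsilon>_def)
  \<comment> \<open>The good set is an intersection of \<open>L\<close> sets, so each may miss only
    \<open>\<delta> / L\<close> of the measure of \<open>K\<close>.\<close>
  have "\<delta> / real L > 0" using \<delta> L by simp
  from mixing_imp_weight_cocycle_bounds[OF lc ap \<mu> w Y mix K \<epsilon>(1) this] obtain N where
    N: "\<And>n. n \<ge> N \<Longrightarrow> \<exists>E\<in>sets \<mu>. emeasure \<mu> (K - E) \<le> ennreal (\<delta> / real L) \<and>
      (\<forall>x\<in>E. 1 / \<epsilon> < weight_cocycle a w n x \<and> weight_cocycle a w n (x + nmult n a) < \<epsilon>)"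
    by metis
  \<comment> \<open>With \<open>n \<ge> 1\<close>, every multiple \<open>m * n\<close> with
    \<open>m \<ge> 1\<close> is also beyond \<open>N\<close>.\<close>
  define n where "n = max N 1"
  have n: "n \<ge> 1" "\<And>m. m \<ge> 1 \<Longrightarrow> m * n \<ge> N"
  proof -
    show "n \<ge> 1" by (simp add: n_def)
    fix m :: nat assume "m \<ge> 1"
    then have "1 * n \<le> m * n" by (rule mult_le_mono1)
    then show "m * n \<ge> N" by (simp add: n_def)
  qed
  have "\<forall>m\<in>{1..L}. \<exists>E\<in>sets \<mu>. emeasure \<mu> (K - E) \<le> ennreal (\<delta> / real L) \<and>
      (\<forall>x\<in>E. 1 / \<epsilon> < weight_cocycle a w (m * n) x \<and>
        weight_cocycle a w (m * n) (x + nmult (m * n) a) < \<epsilon>)"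
    using N n(2) by auto
  then obtain D where D: "\<And>m. m \<in> {1..L} \<Longrightarrow> D m \<in> sets \<mu>"
      "\<And>m. m \<in> {1..L} \<Longrightarrow> emeasure \<mu> (K - D m) \<le> ennreal (\<delta> / real L)"
      "\<And>m x. m \<in> {1..L} \<Longrightarrow> x \<in> D m \<Longrightarrow> 1 / \<epsilon> < weight_cocycle a w (m * n) x"
      "\<And>m x. m \<in> {1..L} \<Longrightarrow> x \<in> D m \<Longrightarrow> weight_cocycle a w (m * n) (x + nmult (m * n) a) < \<epsilon>"
    by metis
  define E where "E = (\<Inter>m\<in>{1..L}. D m)"
  have Es: "E \<in> sets \<mu>" unfolding E_def using D(1) L by (intro sets.finite_INT) auto
  have s: "sets \<mu> = sets borel" using \<mu> by (auto simp: right_haar_measure_def)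
  have Ks: "K \<in> sets \<mu>" unfolding s using compact_imp_closed[OF K] by (rule borel_closed)
  have "emeasure \<mu> (K - E) = emeasure \<mu> (\<Union>m\<in>{1..L}. K - D m)"
    by (rule arg_cong[where f = "emeasure \<mu>"]) (auto simp: E_def)
  also have "\<dots> \<le> (\<Sum>m\<in>{1..L}. emeasure \<mu> (K - D m))"
    using Ks D(1) by (intro emeasure_subadditive_finite) auto
  also have "\<dots> \<le> (\<Sum>m\<in>{1..L}. ennreal (\<delta> / real L))"
    by (intro sum_mono D(2))
  also have "\<dots> = ennreal \<delta>"
    using \<delta> L by (simp add: ennreal_of_nat_eq_real_of_nat flip: ennreal_mult)
  finally have KE: "emeasure \<mu> (K - E) \<le> ennreal \<delta>" .
  define f1 where "f1 = (\<lambda>x. indicator E x * f x)"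
  have f1m: "f1 \<in> borel_measurable \<mu>" unfolding f1_def using Es fm by measurable
  have f1: "f1 \<in> orlicz_functions \<Phi> \<mu>"
    by (rule orlicz_translate_dominated(1)[OF \<mu> Y fm k f1m, of 1 0]) (auto simp: f1_def indicator_def)
  have ff1: "luxemburg_norm \<Phi> \<mu> (\<lambda>x. f x - f1 x) \<le> e / 3"
    unfolding f1_def by (rule trunc[OF Es KE])
  have ED: "x \<in> D m" if "x \<in> E" "m \<in> {1..L}" for x m using that unfolding E_def by blast
  have Tsmall: "(T ^^ (m * n)) f1 \<in> orlicz_functions \<Phi> \<mu> \<and>
      luxemburg_norm \<Phi> \<mu> ((T ^^ (m * n)) f1) \<le> \<epsilon> * k" if m: "m \<in> {1..L}" for m
  proof -
    have o: "(T ^^ (m * n)) f1 \<in> orlicz_functions \<Phi> \<mu>"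
      unfolding T_def by (rule funpow_weighted_shift_orlicz[OF \<mu> w Y f1])
    \<comment> \<open>The image is supported where \<open>x - nmult (m * n) a\<close> lies in
      \<open>E\<close>; there the forward cocycle bound at that point controls the cocycle at
      \<open>x\<close>.\<close>
    have "norm ((T ^^ (m * n)) f1 x) \<le> \<epsilon> * norm (f (x - nmult (m * n) a))" for x
    proof (cases "x - nmult (m * n) a \<in> E")
      case True
      then have "weight_cocycle a w (m * n) x < \<epsilon>" using D(4)[OF m ED[OF _ m]] by fastforce
      then show ?thesis
        using True weight_cocycle_pos[of w a "m * n" x, OF wpos] unfolding T_def funpow_weighted_shift
        by (auto simp: norm_mult f1_def intro!: mult_right_mono)
    qed (use \<epsilon> in \<open>auto simp: T_def funpow_weighted_shift f1_def\<close>)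
    then show ?thesis
      using o orlicz_translate_dominated(2)[OF \<mu> Y fm k _ \<epsilon>(1)] by (auto simp: orlicz_functions_def)
  qed
  have Ssmall: "(S ^^ (m * n)) f1 \<in> orlicz_functions \<Phi> \<mu> \<and>
      luxemburg_norm \<Phi> \<mu> ((S ^^ (m * n)) f1) \<le> \<epsilon> * k" if m: "m \<in> {1..L}" for m
  proof -
    \<comment> \<open>The domination below yields membership in the Orlicz space together with the
      norm bound, so only measurability is prepared.\<close>
    have o: "(S ^^ (m * n)) f1 \<in> borel_measurable \<mu>"
      unfolding S_def by (rule measurable_weighted_unshift[OF \<mu> w f1m])
    have "norm ((S ^^ (m * n)) f1 x) \<le> \<epsilon> * norm (f (x - (- nmult (m * n) a)))" for x
    proof (cases "x + nmult (m * n) a \<in> E")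
      case True
      define y where "y = x + nmult (m * n) a"
      have W: "1 / \<epsilon> < weight_cocycle a w (m * n) y" using D(3)[OF m ED[OF True m]] by (simp add: y_def)
      then have "1 / weight_cocycle a w (m * n) y \<le> \<epsilon>"
        using \<epsilon> weight_cocycle_pos[of w a "m * n" y, OF wpos] by (simp add: field_simps)
      then have "1 / weight_cocycle a w (m * n) y * norm (f y) \<le> \<epsilon> * norm (f y)"
        by (rule mult_right_mono) simp
      then show ?thesis
        using True weight_cocycle_pos[of w a "m * n" y, OF wpos] unfolding S_def funpow_weighted_unshift
        by (simp add: norm_divide f1_def y_def)
    qed (use \<epsilon> in \<open>auto simp: S_def funpow_weighted_unshift f1_def\<close>)
    then show ?thesis
      using orlicz_translate_dominated[OF \<mu> Y fm k o \<epsilon>(1)] by blast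
  qed
  \<comment> \<open>The \<open>l\<close>-th summand of \<open>T^j^n h\<close>; cancellation makes it
    \<open>f1\<close> for \<open>l = j\<close>, and a small forward or backward iterate of
    \<open>f1\<close> otherwise.\<close>
  define u where "u j l = (T ^^ (j * n)) ((S ^^ (l * n)) f1)" for j l
  have u_eq: "u j l = (if l \<le> j then (T ^^ ((j - l) * n)) f1 else (S ^^ ((l - j) * n)) f1)" for j l
    using n(1) funpow_weighted_shift_unshift[where w = w and a = a, OF wpos]
    by (auto simp: u_def T_def S_def diff_mult_distrib)
  have u_diag: "u j j = f1" for j by (simp add: u_eq)
  have u_off: "u j l \<in> orlicz_functions \<Phi> \<mu> \<and> luxemburg_norm \<Phi> \<mu> (u j l) \<le> \<epsilon> * k"
    if "j \<le> L" "l \<le> L" "l \<noteq> j" for j l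
  proof (cases "l \<le> j")
    case True
    then have "j - l \<in> {1..L}" using that by auto
    from Tsmall[OF this] show ?thesis using True by (simp add: u_eq)
  next
    case False
    then have "l - j \<in> {1..L}" using that by auto
    from Ssmall[OF this] show ?thesis using False by (simp add: u_eq)
  qed
  have u_orl: "u j l \<in> orlicz_functions \<Phi> \<mu>" if "j \<le> L" "l \<le> L" for j l
    using u_off[OF that] u_diag f1 by (cases "l = j") auto
  define h where "h = (\<lambda>x. \<Sum>l\<le>L. (S ^^ (l * n)) f1 x)"
  have Th: "(T ^^ (j * n)) h = (\<lambda>x. \<Sum>l\<le>L. u j l x)" for j
    by (rule ext) (simp add: h_def u_def T_def funpow_weighted_shift sum_distrib_left)
  have Th_orl: "(T ^^ (j * n)) h \<in> orlicz_functions \<Phi> \<mu>" if "j \<le> L" for j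
    unfolding Th using u_orl[OF that] by (intro orlicz_functions_sum(1)[OF Y]) auto
  have near: "luxemburg_norm \<Phi> \<mu> (\<lambda>x. f x - (T ^^ (j * n)) h x) < e" if j: "j \<le> L" for j
  proof -
    \<comment> \<open>The off-diagonal part has exactly \<open>L\<close> summands, since
      \<open>{..L}\<close> has \<open>L + 1\<close> elements.\<close>
    define r where "r = (\<lambda>x. \<Sum>l\<in>{..L} - {j}. u j l x)"
    have r: "r \<in> orlicz_functions \<Phi> \<mu>"
      and "luxemburg_norm \<Phi> \<mu> r \<le> (\<Sum>l\<in>{..L} - {j}. luxemburg_norm \<Phi> \<mu> (u j l))"
      unfolding r_def using u_orl[OF j] by (intro orlicz_functions_sum[OF Y]; simp)+
    note this(2)
    also have "\<dots> \<le> (\<Sum>l\<in>{..L} - {j}. \<epsilon> * k)" using u_off[OF j] by (intro sum_mono) auto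
    also have "\<dots> = e / 3" using j \<epsilon>(2) by simp
    finally have r_le: "luxemburg_norm \<Phi> \<mu> r \<le> e / 3" .
    define r' where "r' = (\<lambda>x. - 1 * r x)"
    have r': "r' \<in> orlicz_functions \<Phi> \<mu>" unfolding r'_def by (rule orlicz_functions_cmult[OF Y r])
    have r'_eq: "luxemburg_norm \<Phi> \<mu> r' = luxemburg_norm \<Phi> \<mu> r"
      by (intro luxemburg_norm_AE_cong) (simp add: r'_def)
    have "(\<lambda>x. f x - (T ^^ (j * n)) h x) = (\<lambda>x. (f x - f1 x) + r' x)"
      unfolding Th using j by (auto simp: r_def r'_def sum.remove[of "{..L}" j] u_diag)
    then have "luxemburg_norm \<Phi> \<mu> (\<lambda>x. f x - (T ^^ (j * n)) h x) \<le>
        luxemburg_norm \<Phi> \<mu> (\<lambda>x. f x - f1 x) + luxemburg_norm \<Phi> \<mu> r'"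
      using luxemburg_norm_triangle[OF Y orlicz_functions_diff[OF Y f f1] r'] by simp
    then show ?thesis using ff1 r_le r'_eq e by simp
  qed
  have ret: "(weighted_translation \<Phi> \<mu> a w ^^ (j * n)) (orlicz_class \<Phi> \<mu> h) \<in> U" if "j \<le> L" for j
    using ball[OF Th_orl[OF that] near[OF that]] Th_orl[of 0]
      funpow_weighted_translation_class[OF \<mu> w Y, where f = h and a = a and n = "j * n"] by (simp add: T_def)
  \<comment> \<open>The case \<open>j = 0\<close> places the class of \<open>h\<close> itself in
    \<open>U\<close>.\<close>
  have "orlicz_class \<Phi> \<mu> h \<in> U \<inter> (\<Inter>l\<in>{1..L}. (weighted_translation \<Phi> \<mu> a w ^^ (l * n)) -` U)"
    using ret[of 0] ret by auto
  then show "\<exists>n\<ge>1. U \<inter> (\<Inter>l\<in>{1..L}. (weighted_translation \<Phi> \<mu> a w ^^ (l * n)) -` U) \<noteq> {}"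
    using n(1) by blast
qed

theorem corollary3p3:
  fixes a :: "'g::{topological_group_add, t2_space, second_countable_topology}"
    and \<mu> :: "'g measure"
    and w :: "'g \<Rightarrow> real"
    and \<Phi> :: "real \<Rightarrow> real"
  assumes "locally_compact_space (euclidean :: 'g topology)"
    and "right_haar_measure \<mu>"
    and "aperiodic a"
    and "weight w"
    and "w \<in> L_infinity \<mu>"
    and "(\<lambda>x. inverse (w x)) \<in> L_infinity \<mu>"
    and "young_function \<Phi>"
    and "delta2_regular (UNIV :: 'g set) \<Phi>"
    and "chaotic (orlicz_topology \<Phi> \<mu>) (weighted_translation \<Phi> \<mu> a w) \<or>
         topologically_mixing (orlicz_topology \<Phi> \<mu>) (weighted_translation \<Phi> \<mu> a w)"
  shows "topologically_multiply_recurrent (orlicz_topology \<Phi> \<mu>) (weighted_translation \<Phi> \<mu> a w)"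
  using assms(9)
proof
  assume "chaotic (orlicz_topology \<Phi> \<mu>) (weighted_translation \<Phi> \<mu> a w)"
  then show ?thesis by (rule chaotic_imp_multiply_recurrent)
next
  assume mix: "topologically_mixing (orlicz_topology \<Phi> \<mu>) (weighted_translation \<Phi> \<mu> a w)"
  have "closed (closed_subgroup_generated a)"
    unfolding closed_subgroup_generated_def hull_def by (intro closed_Inter) auto
  \<comment> \<open>In a compact group the closed subgroup generated by \<open>a\<close> would be
    compact. Noncompactness selects the form of the \<open>\<Delta>\<close>2-condition valid for all
    \<open>t > 0\<close>.\<close>
  then have "\<not> compact (UNIV :: 'g set)"
    using assms(3) compact_Int_closed[of UNIV "closed_subgroup_generated a"]
    unfolding aperiodic_def by auto
  then obtain M where "M > 0" "\<And>t. t > 0 \<Longrightarrow> \<Phi> (2 * t) \<le> M * \<Phi> t"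
    using assms(8) unfolding delta2_regular_def by auto
  then show ?thesis
    using mixing_imp_multiply_recurrent[OF assms(1,3,2,4,7) _ _ mix] by blast
qed

end
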